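(* Let $(X(t),\Lambda(t))$ be the regime-switching jump diffusion on $\mathbb{R}^d\times\mathcal{M}$ with generator $\mathcal{G}$ described in the context, under the standing assumptions listed there. Let $D\subset\mathbb{R}^d$ be a bounded domain. Suppose that for each $i\in\mathcal{M}$ there exists a nonnegative function $V(\cdot,i)\in C^2(\mathbb{R}^d)$ such that $$\mathcal{G}V(x,i)\le 0\quad\text{for all }(x,i)\in D^c\times\mathcal{M},\qquad\text{and}\qquad \inf_{|x|\ge n,\ i\in\mathcal{M}}V(x,i)\to\infty\ \text{ as } n\to\infty.$$ Then $(X(t),\Lambda(t))$ is recurrent with respect to $U=D\times\mathcal{M}$.
   Context: A domain in $\mathbb{R}^d$ is a nonempty connected open set. $B(x,r)$ is the open ball of radius $r$ centered at $x$; $D^c=\mathbb{R}^d\setminus D$. $\mathcal{M}=\{1,\dots,m\}$ is a finite set. $C^2_b(\mathbb{R}^d)$ is the class of $C^2$ functions whose partial derivatives up to order 2 (including order 0) are bounded. Data: $b:\mathbb{R}^d\times\mathcal{M}\to\mathbb{R}^d$; $\sigma$ on $\mathbb{R}^d\times\mathcal{M}$ with values in $d\times d$ real matrices; $a(x,i)=\sigma(x,i)\sigma(x,i)'$; for each $(x,i)$ a $\sigma$-finite measure $\pi_i(x,dz)$ on $\mathbb{R}^d$ with $\int(1\wedge|z|^2)\pi_i(x,dz)<\infty$; and an $m\times m$ matrix $Q(x)=(q_{ij}(x))$ with $q_{ij}(x)\ge0$ for $i\ne j$ and $\sum_{j}q_{ij}(x)=0$. For $f:\mathbb{R}^d\times\mathcal{M}\to\mathbb{R}$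 with each $f(\cdot,i)\in C^2(\mathbb{R}^d)$, the generator is $$\mathcal{G}f(x,i)=\tfrac12\sum_{k,l=1}^d a_{kl}(x,i)\tfrac{\partial^2 f(x,i)}{\partial x_k\partial x_l}+\sum_{k=1}^d b_k(x,i)\tfrac{\partial f(x,i)}{\partial x_k}+\int_{\mathbb{R}^d}\big(f(x+z,i)-f(x,i)-\nabla f(x,i)\cdot z\,\mathbf{1}_{\{|z|<1\}}\big)\pi_i(x,dz)+\sum_{j\in\mathcal{M}}q_{ij}(x)f(x,j).$$ Standing assumptions: (1) For each $i$, $\sigma(\cdot,i)$ and $b(\cdot,i)$ are continuous, and $\sum_{k,l}|\sigma_{kl}(x,i)|+\sum_k|b_k(x,i)|\le c(1+|x|)$ on $\mathbb{R}^d$ for some $c>0$; each $q_{ij}$ is bounded and Borel measurable on $\mathbb{R}^d$. (2) For every bounded domain $D\subset\mathbb{R}^d$ there is $\kappa_0=\kappa_0(D)\in(0,1]$ with $\kappa_0|\xi|^2\le\xi'a(x,i)\xi\le\kappa_0^{-1}|\xi|^2$ for all $\xi\in\mathbb{R}^d$, $x\in D$, $i\in\mathcal{M}$. (3) $\sup_{x\in\mathbb{R}^d,i\in\mathcal{M}}\pi_i(x,B(0,1)^c)<\infty$, and for some $c>0$, $\sup_{i\in\mathcal{M}}\int_{B(0,1)}|z|^2\pi_i(x,dz)\le c(1+|x|^2)$ for all $x$. For every $n\ge1$ there is a $\sigma$-finite measure $\Pi_n(dz)$ with $\int(1\wedge|z|^2)\Pi_n(dz)<\infty$ and $\pi_i(x,dz)\le\Pi_n(dz)$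 for all $x\in B(0,n)$, $i\in\mathcal{M}$. (4) $\pi_i(x,dz)=\widetilde\pi_i(x,z)\,dz$ for all $i,x$. For any $r\in(0,1)$, any $x_0\in\mathbb{R}^d$, any $x,y\in B(x_0,r/2)$ and $z\in B(x_0,r)^c$, $\widetilde\pi_i(x,z-x)\le\alpha_r\widetilde\pi_i(y,z-y)$, where $1<\alpha_r<\kappa_2r^{-\beta}$ with $\kappa_2,\beta$ positive constants. The process: $\mathbb{P}_{x,i}$ is the law, on the Skorohod space of right-continuous paths with left limits in $\mathbb{R}^d\times\mathcal{M}$, of the solution of the martingale problem for $(\mathcal{G},C^2_b(\mathbb{R}^d))$ started at $(x,i)$: $\mathbb{P}_{x,i}(X(0)=x,\Lambda(0)=i)=1$, and for every $f$ with $f(\cdot,j)\in C_b^2(\mathbb{R}^d)$ for all $j$, $f(X(t),\Lambda(t))-f(X(0),\Lambda(0))-\int_0^t\mathcal{G}f(X(s),\Lambda(s))ds$ is a $\mathbb{P}_{x,i}$-martingale. Under the standing assumptions this solution is known to exist and be unique for each $(x,i)$, and $(X(t),\Lambda(t))$ is a strong Markov process with infinite lifetime (no explosion). $\mathbb{E}_{x,i}$ is expectation under $\mathbb{P}_{x,i}$. Recurrence: for $U=D\times J$ with $D\subset\mathbb{R}^d$ a bounded domain and $J\subset\mathcal{M}$, let $\sigma_U=\inf\{t\ge0:(X(t),\Lambda(t))\in U\}$. The process is recurrent with respect to $U$ if $\mathbb{P}_{x,i}(\sigma_U<\infty)=1$ for all $(x,i)\in U^c$. *)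

theory Defs
  imports "HOL-Probability.Probability"
begin

section \<open>Function classes and domains\<close>

definition is_domain :: "'a::topological_space set \<Rightarrow> bool" where
  "is_domain D \<longleftrightarrow> D \<noteq> {} \<and> open D \<and> connected D"

definition partial :: "'n::finite \<Rightarrow> (real^'n \<Rightarrow> real) \<Rightarrow> real^'n \<Rightarrow> real" where
  "partial k f x = frechet_derivative f (at x) (axis k 1)"

definition grad :: "(real^'n::finite \<Rightarrow> real) \<Rightarrow> real^'n \<Rightarrow> real^'n" where
  "grad f x = (\<chi> k. partial k f x)"

text \<open>The differentiability clauses make the values of \<^const>\<open>frechet_derivative\<close> meaningful;
  continuity of the first-order partial derivatives follows from their differentiability.\<close>

definition C2 :: "(real^'n::finite \<Rightarrow> real) \<Rightarrow> bool" where
  "C2 f \<longleftrightarrow>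
     (\<forall>x. f differentiable (at x)) \<and>
     (\<forall>k x. partial k f differentiable (at x)) \<and>
     (\<forall>k l. continuous_on UNIV (partial k (partial l f)))"

definition C2b :: "(real^'n::finite \<Rightarrow> real) \<Rightarrow> bool" where
  "C2b f \<longleftrightarrow>
     C2 f \<and> bounded (range f) \<and> (\<forall>k. bounded (range (partial k f))) \<and>
     (\<forall>k l. bounded (range (partial k (partial l f))))"


section \<open>The generator\<close>

text \<open>The regimes are the elements of a finite type \<open>'m\<close>; \<open>\<pi> i x\<close> is the measure
  $\pi_i(x,dz)$. For unbounded \<open>f\<close> the jump integral may diverge; the value of \<open>generator\<close> is
  meaningful only when \<open>jump_integrand\<close> is integrable, which has to be required separately.\<close>

definition diffusion_matrix ::
    "(real^'n \<Rightarrow> 'm \<Rightarrow> real^'n^'n) \<Rightarrow> real^'n::finite \<Rightarrow> 'm \<Rightarrow> real^'n^'n" where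
  "diffusion_matrix \<sigma> x i = \<sigma> x i ** transpose (\<sigma> x i)"

definition jump_integrand ::
    "(real^'n::finite \<Rightarrow> real) \<Rightarrow> real^'n \<Rightarrow> real^'n \<Rightarrow> real" where
  "jump_integrand f x z = f (x + z) - f x - (grad f x \<bullet> z) * indicator {z. norm z < 1} z"

definition generator ::
    "(real^'n \<Rightarrow> 'm \<Rightarrow> real^'n) \<Rightarrow> (real^'n \<Rightarrow> 'm \<Rightarrow> real^'n^'n) \<Rightarrow>
     ('m \<Rightarrow> real^'n \<Rightarrow> (real^'n) measure) \<Rightarrow> (real^'n \<Rightarrow> real^'m^'m) \<Rightarrow>
     (real^'n::finite \<Rightarrow> 'm::finite \<Rightarrow> real) \<Rightarrow> real^'n \<Rightarrow> 'm \<Rightarrow> real" where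
  "generator b \<sigma> \<pi> Q f x i =
     (1/2) * (\<Sum>k\<in>UNIV. \<Sum>l\<in>UNIV.
        diffusion_matrix \<sigma> x i $ k $ l * partial k (partial l (\<lambda>y. f y i)) x)
     + (\<Sum>k\<in>UNIV. b x i $ k * partial k (\<lambda>y. f y i) x)
     + (\<integral>z. jump_integrand (\<lambda>y. f y i) x z \<partial>\<pi> i x)
     + (\<Sum>j\<in>UNIV. Q x $ i $ j * f x j)"


section \<open>Standing assumptions\<close>

definition levy_measure :: "(real^'n::finite) measure \<Rightarrow> bool" where
  "levy_measure \<nu> \<longleftrightarrow>
     sets \<nu> = sets borel \<and> sigma_finite_measure \<nu> \<and>
     (\<integral>\<^sup>+z. ennreal (min 1 ((norm z)\<^sup>2)) \<partial>\<nu>) < \<infinity>"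

locale regime_switching_jump_diffusion =
  fixes b :: "real^'n::finite \<Rightarrow> 'm::finite \<Rightarrow> real^'n"
    and \<sigma> :: "real^'n \<Rightarrow> 'm \<Rightarrow> real^'n^'n"
    and \<pi> :: "'m \<Rightarrow> real^'n \<Rightarrow> (real^'n) measure"
    and Q :: "real^'n \<Rightarrow> real^'m^'m"
  assumes levy: "\<And>x i. levy_measure (\<pi> i x)"
    and Q_nonneg: "\<And>x i j. i \<noteq> j \<Longrightarrow> 0 \<le> Q x $ i $ j"
    and Q_row_sum: "\<And>x i. (\<Sum>j\<in>UNIV. Q x $ i $ j) = 0"
    and sigma_continuous: "\<And>i. continuous_on UNIV (\<lambda>x. \<sigma> x i)"
    and b_continuous: "\<And>i. continuous_on UNIV (\<lambda>x. b x i)"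
    and linear_growth:
      "\<exists>c>0. \<forall>x i. (\<Sum>k\<in>UNIV. \<Sum>l\<in>UNIV. \<bar>\<sigma> x i $ k $ l\<bar>) + (\<Sum>k\<in>UNIV. \<bar>b x i $ k\<bar>)
                    \<le> c * (1 + norm x)"
    and Q_bounded: "\<And>i j. bounded (range (\<lambda>x. Q x $ i $ j))"
    and Q_measurable: "\<And>i j. (\<lambda>x. Q x $ i $ j) \<in> borel_measurable borel"
    and local_ellipticity:
      "\<And>D. is_domain D \<Longrightarrow> bounded D \<Longrightarrow>
         \<exists>\<kappa>\<^sub>0>0. \<kappa>\<^sub>0 \<le> 1 \<and> (\<forall>\<xi>. \<forall>x\<in>D. \<forall>i.
           \<kappa>\<^sub>0 * (norm \<xi>)\<^sup>2 \<le> \<xi> \<bullet> (diffusion_matrix \<sigma> x i *v \<xi>) \<and>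
           \<xi> \<bullet> (diffusion_matrix \<sigma> x i *v \<xi>) \<le> inverse \<kappa>\<^sub>0 * (norm \<xi>)\<^sup>2)"
    and big_jumps: "(SUP (x, i)\<in>UNIV. emeasure (\<pi> i x) (- ball 0 1)) < \<infinity>"
    and small_jumps:
      "\<exists>c>0. \<forall>x. (SUP i. \<integral>\<^sup>+z\<in>ball 0 1. ennreal ((norm z)\<^sup>2) \<partial>\<pi> i x)
                    \<le> ennreal (c * (1 + (norm x)\<^sup>2))"
    and local_domination:
      "\<And>n::nat. 1 \<le> n \<Longrightarrow>
         \<exists>\<nu>. levy_measure \<nu> \<and>
             (\<forall>x\<in>ball 0 (real n). \<forall>i. \<forall>A\<in>sets borel. emeasure (\<pi> i x) A \<le> emeasure \<nu> A)"
    and jump_density: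
      "\<exists>(p :: 'm \<Rightarrow> real^'n \<Rightarrow> real^'n \<Rightarrow> real) \<kappa>\<^sub>2 \<beta>.
         0 < \<kappa>\<^sub>2 \<and> 0 < \<beta> \<and>
         (\<forall>i x. p i x \<in> borel_measurable borel \<and> (\<forall>z. 0 \<le> p i x z) \<and>
                \<pi> i x = density lborel (\<lambda>z. ennreal (p i x z))) \<and>
         (\<forall>r\<in>{0<..<1}. \<exists>\<alpha>. 1 < \<alpha> \<and> \<alpha> < \<kappa>\<^sub>2 * r powr (- \<beta>) \<and>
            (\<forall>i x\<^sub>0. \<forall>x\<in>ball x\<^sub>0 (r/2). \<forall>y\<in>ball x\<^sub>0 (r/2). \<forall>z\<in>- ball x\<^sub>0 r.
               p i x (z - x) \<le> \<alpha> * p i y (z - y)))"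


section \<open>The martingale problem on the Skorohod space\<close>

text \<open>The set of regimes carries the discrete topology, so one-sided limits in the second
  coordinate mean that it is eventually constant. The conditions only concern times in
  $[0,\infty)$.\<close>

definition cadlag :: "(real \<Rightarrow> (real^'n::finite) \<times> 'm) \<Rightarrow> bool" where
  "cadlag \<omega> \<longleftrightarrow>
     (\<forall>t\<ge>0. ((\<lambda>s. fst (\<omega> s)) \<longlongrightarrow> fst (\<omega> t)) (at_right t) \<and>
             (\<forall>\<^sub>F s in at_right t. snd (\<omega> s) = snd (\<omega> t))) \<and>
     (\<forall>t>0. (\<exists>l. ((\<lambda>s. fst (\<omega> s)) \<longlongrightarrow> l) (at_left t)) \<and>
             (\<exists>j. \<forall>\<^sub>F s in at_left t. snd (\<omega> s) = j))"

definition state_space :: "((real^'n::finite) \<times> 'm) measure" where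
  "state_space = borel \<Otimes>\<^sub>M count_space UNIV"

text \<open>Paths are functions on $[0,\infty)$ (extended by \<^const>\<open>undefined\<close>). The \<open>\<sigma>\<close>-algebra is the
  one generated by the coordinate maps; it is the Borel \<open>\<sigma>\<close>-algebra of the Skorohod topology.\<close>

definition skorohod_space :: "(real \<Rightarrow> (real^'n::finite) \<times> 'm) measure" where
  "skorohod_space = restrict_space (\<Pi>\<^sub>M t\<in>{0..}. state_space) {\<omega>. cadlag \<omega>}"

text \<open>The \<open>\<sigma>\<close>-algebra generated by the coordinates at times in $[0,t]$.\<close>

definition path_filtration :: "real \<Rightarrow> (real \<Rightarrow> (real^'n::finite) \<times> 'm) measure" where
  "path_filtration t =
     vimage_algebra (space skorohod_space) (\<lambda>\<omega>. restrict \<omega> {0..t}) (\<Pi>\<^sub>M s\<in>{0..t}. state_space)"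

definition is_martingale ::
    "'a measure \<Rightarrow> (real \<Rightarrow> 'a measure) \<Rightarrow> (real \<Rightarrow> 'a \<Rightarrow> real) \<Rightarrow> bool" where
  "is_martingale M F X \<longleftrightarrow>
     (\<forall>t\<ge>0. X t \<in> borel_measurable (F t) \<and> integrable M (X t)) \<and>
     (\<forall>s\<ge>0. \<forall>t\<ge>s. AE \<omega> in M. real_cond_exp M (F s) (X t) \<omega> = X s \<omega>)"

text \<open>The last clause asks, besides the martingale property, that the time integral of
  $\mathcal{G}f$ along the path exists almost surely, since the Bochner integral of a non-integrable
  function is 0 by convention. The process has infinite lifetime because paths in
  \<^const>\<open>skorohod_space\<close> are defined on all of $[0,\infty)$.\<close>

definition solves_martingale_problem ::
    "(real^'n \<Rightarrow> 'm \<Rightarrow> real^'n) \<Rightarrow> (real^'n \<Rightarrow> 'm \<Rightarrow> real^'n^'n) \<Rightarrow>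
     ('m \<Rightarrow> real^'n \<Rightarrow> (real^'n) measure) \<Rightarrow> (real^'n \<Rightarrow> real^'m^'m) \<Rightarrow>
     real^'n::finite \<Rightarrow> 'm::finite \<Rightarrow> (real \<Rightarrow> (real^'n) \<times> 'm) measure \<Rightarrow> bool" where
  "solves_martingale_problem b \<sigma> \<pi> Q x i P \<longleftrightarrow>
     prob_space P \<and> sets P = sets skorohod_space \<and>
     measure P {\<omega> \<in> space P. \<omega> 0 = (x, i)} = 1 \<and>
     (\<forall>f. (\<forall>j. C2b (\<lambda>y. f y j)) \<longrightarrow>
        (let Gf = (\<lambda>\<omega> s. generator b \<sigma> \<pi> Q f (fst (\<omega> s)) (snd (\<omega> s))) in
          (AE \<omega> in P. \<forall>t\<ge>0. set_integrable lborel {0..t} (Gf \<omega>)) \<and>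
          is_martingale P path_filtration
            (\<lambda>t \<omega>. f (fst (\<omega> t)) (snd (\<omega> t)) - f (fst (\<omega> 0)) (snd (\<omega> 0))
                    - (LINT s:{0..t}|lborel. Gf \<omega> s))))"


section \<open>Recurrence\<close>

definition hitting_time :: "'s set \<Rightarrow> (real \<Rightarrow> 's) \<Rightarrow> ereal" where
  "hitting_time U \<omega> = Inf {ereal t | t. 0 \<le> t \<and> \<omega> t \<in> U}"

definition recurrent ::
    "(real^'n::finite \<Rightarrow> 'm \<Rightarrow> (real \<Rightarrow> (real^'n) \<times> 'm) measure) \<Rightarrow> ((real^'n) \<times> 'm) set \<Rightarrow> bool" where
  "recurrent P U \<longleftrightarrow>
     (\<forall>x i. (x, i) \<notin> U \<longrightarrow>
        measure (P x i) {\<omega> \<in> space (P x i). hitting_time U \<omega> < \<infinity>} = 1)"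

end

theory Submission
  imports Defs
begin

text \<open>
  Fix \<open>m, \<delta> > 0\<close>. For a bounded concave nondecreasing \<open>C\<^sup>2\<close> function \<open>\<phi>\<close> with \<open>\<phi> v \<le> 1 + v\<close> that is
  constant for \<open>v \<ge> 3 * m\<close>, $\mathcal{G}(\phi \circ V) \le \phi'(V)\, \mathcal{G}V \le 0$ off \<open>D\<close>, and
  \<open>\<phi> \<circ> V\<close> is constant outside a ball of radius \<open>n\<close>, hence an admissible test function. Ellipticity yields
  a test function \<open>H\<close> with values in $[0,1]$ and $\mathcal{G}H \le -c < 0$ on that ball. Put
  \<open>W = (2 / m) * \<phi>(V) + \<delta> * H\<close>.

  Instead of stopping the process on hitting \<open>D\<close> or leaving the ball, kill it at the rate \<open>\<rho>(X)\<close>, where \<open>\<rho>\<close>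
  is a large constant on \<open>D\<close> and outside the ball, and \<open>\<delta> * c\<close> elsewhere. Since \<open>W \<ge> 2\<close> outside the ball
  and \<open>W \<ge> 2 / m\<close> everywhere, $\mathcal{G}W - \rho W \le -\rho 1_{D^c}$. With $Z_t = \exp(-\int_0^t \rho(X_s)\,ds)$ and \<open>N\<close> the event that
  \<open>D\<close> is never hit, the function $E[Z_t W(X_t,\Lambda_t)] - E[1_N Z_t]$ is therefore nonincreasing in \<open>t\<close>.
  As \<open>\<rho>\<close> is bounded below by a positive constant, \<open>t \<rightarrow> \<infinity>\<close> gives
  $P(N) \le W(x,i) \le \frac{2}{m} (1 + V(x,i)) + \delta$. Now let \<open>m \<rightarrow> \<infinity>\<close> and \<open>\<delta> \<rightarrow> 0\<close>.
\<close>

section \<open>Calculus of $C^2$ functions\<close>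

lemma grad_inner_eq: "grad f x \<bullet> v = (\<Sum>k\<in>UNIV. v $ k * partial k f x)"
  by (simp add: grad_def inner_vec_def mult.commute)

lemma frechet_derivative_grad:
  assumes "f differentiable (at x)"
  shows "frechet_derivative f (at x) v = grad f x \<bullet> v"
proof -
  have lin: "linear (frechet_derivative f (at x))"
    using assms by (rule linear_frechet_derivative)
  have "frechet_derivative f (at x) v = frechet_derivative f (at x) (\<Sum>k\<in>UNIV. v $ k *\<^sub>R axis k 1)"
    using basis_expansion[of v, symmetric] by (simp only: scalar_mult_eq_scaleR)
  also have "\<dots> = grad f x \<bullet> v"
    by (simp only: linear_sum[OF lin] linear_cmul[OF lin] grad_inner_eq partial_def real_scaleR_def)
  finally show ?thesis .
qed

lemma has_derivative_grad:
  assumes "f differentiable (at x)"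
  shows "(f has_derivative (\<lambda>v. grad f x \<bullet> v)) (at x)"
proof -
  have "(f has_derivative frechet_derivative f (at x)) (at x)"
    using assms by (simp add: frechet_derivative_works)
  moreover have "frechet_derivative f (at x) = (\<lambda>v. grad f x \<bullet> v)"
    by (rule ext) (rule frechet_derivative_grad[OF assms])
  ultimately show ?thesis by simp
qed

lemma partial_eqI: "(f has_derivative f') (at x) \<Longrightarrow> partial k f x = f' (axis k 1)"
  unfolding partial_def using frechet_derivative_at by metis

lemma partial_grad: "f differentiable (at x) \<Longrightarrow> partial k f x = grad f x \<bullet> axis k 1"
  by (rule partial_eqI[OF has_derivative_grad])

lemma partial_cong_open:
  assumes "open S" "x \<in> S" "\<And>y. y \<in> S \<Longrightarrow> f y = g y"
  shows "partial k f x = partial k g x"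
proof -
  have "(f has_derivative f') (at x) \<longleftrightarrow> (g has_derivative f') (at x)" for f'
    using has_derivative_transform_within_open[OF _ assms(1,2), of f f' UNIV g]
      has_derivative_transform_within_open[OF _ assms(1,2), of g f' UNIV f] assms(3) by auto
  then show ?thesis by (simp add: partial_def frechet_derivative_def)
qed

lemma partial_const [simp]: "partial k (\<lambda>x. c) x = 0"
  by (rule partial_eqI[THEN trans, OF has_derivative_const]) simp

text \<open>The strict inequality on the norm gives an open region on which \<open>f\<close> is
  constant, and derivatives are local.\<close>

lemma partial_eq_0_outside:
  assumes "\<And>x. R \<le> norm x \<Longrightarrow> f x = c" "R < norm x"
  shows "partial k f x = 0"
proof -
  have "open {x::real^'n. R < norm x}" by (intro open_Collect_less continuous_intros)
  then have "partial k f x = partial k (\<lambda>_. c) x"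
    using assms by (intro partial_cong_open[of "{x. R < norm x}"]) auto
  then show ?thesis by simp
qed

lemma C2_differentiable: "C2 f \<Longrightarrow> f differentiable (at x)"
  and C2_partial_differentiable: "C2 f \<Longrightarrow> partial k f differentiable (at x)"
  and C2_partial2_continuous: "C2 f \<Longrightarrow> continuous_on UNIV (partial k (partial l f))"
  by (auto simp: C2_def)

lemma C2_continuous: "C2 f \<Longrightarrow> continuous_on S f"
  and C2_partial_continuous: "C2 f \<Longrightarrow> continuous_on S (partial k f)"
  using C2_differentiable[of f] C2_partial_differentiable[of f]
  by (auto intro!: continuous_at_imp_continuous_on differentiable_imp_continuous_within)

lemma C2_const: "C2 (\<lambda>x. c)"
proof -
  have [simp]: "partial k (\<lambda>x. c) = (\<lambda>x. 0)" for k :: 'a and c by (rule ext) simp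
  show ?thesis by (auto simp: C2_def)
qed

lemma partial_linear_combination:
  assumes "f differentiable (at x)" "g differentiable (at x)"
  shows "partial k (\<lambda>x. \<alpha> * f x + \<beta> * g x) x = \<alpha> * partial k f x + \<beta> * partial k g x"
proof -
  have "((\<lambda>x. \<alpha> * f x + \<beta> * g x) has_derivative (\<lambda>v. \<alpha> * (grad f x \<bullet> v) + \<beta> * (grad g x \<bullet> v))) (at x)"
    by (intro has_derivative_add has_derivative_mult_right has_derivative_grad assms)
  from partial_eqI[OF this, of k] show ?thesis
    by (simp only: partial_grad[OF assms(1)] partial_grad[OF assms(2)])
qed

lemma partial2_linear_combination:
  assumes "C2 f" "C2 g"
  shows "partial k (partial l (\<lambda>x. \<alpha> * f x + \<beta> * g x)) x
    = \<alpha> * partial k (partial l f) x + \<beta> * partial k (partial l g) x"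
proof -
  have "partial l (\<lambda>x. \<alpha> * f x + \<beta> * g x) = (\<lambda>x. \<alpha> * partial l f x + \<beta> * partial l g x)"
    using assms by (intro ext partial_linear_combination C2_differentiable)
  then show ?thesis
    using assms by (simp add: partial_linear_combination C2_partial_differentiable)
qed

lemma C2_linear_combination:
  assumes "C2 f" "C2 g"
  shows "C2 (\<lambda>x. \<alpha> * f x + \<beta> * g x)"
proof -
  note d = C2_differentiable[OF assms(1)] C2_differentiable[OF assms(2)]
    C2_partial_differentiable[OF assms(1)] C2_partial_differentiable[OF assms(2)]
  have eq: "partial l (\<lambda>x. \<alpha> * f x + \<beta> * g x) = (\<lambda>x. \<alpha> * partial l f x + \<beta> * partial l g x)" for l
    using assms by (intro ext partial_linear_combination C2_differentiable)
  have eq2: "partial k (\<lambda>x. \<alpha> * partial l f x + \<beta> * partial l g x)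
     = (\<lambda>x. \<alpha> * partial k (partial l f) x + \<beta> * partial k (partial l g) x)" for k l
    using d by (intro ext partial_linear_combination)
  show ?thesis unfolding C2_def eq eq2
    using d C2_partial2_continuous[OF assms(1)] C2_partial2_continuous[OF assms(2)]
    by (auto intro!: continuous_intros differentiable_add differentiable_mult)
qed

lemma partial_compose:
  assumes "f differentiable (at x)" "(\<phi> has_real_derivative d) (at (f x))"
  shows "partial k (\<lambda>x. \<phi> (f x)) x = d * partial k f x"
proof -
  have "((\<lambda>x. \<phi> (f x)) has_derivative (\<lambda>v. d * (grad f x \<bullet> v))) (at x)"
    using has_derivative_compose[OF has_derivative_grad[OF assms(1)]] assms(2)
    by (simp add: has_field_derivative_def)
  from partial_eqI[OF this, of k] show ?thesis
    by (simp only: partial_grad[OF assms(1)])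
qed

lemma partial_mult:
  assumes "f differentiable (at x)" "g differentiable (at x)"
  shows "partial k (\<lambda>x. f x * g x) x = f x * partial k g x + partial k f x * g x"
proof -
  have "((\<lambda>x. f x * g x) has_derivative (\<lambda>v. f x * (grad g x \<bullet> v) + (grad f x \<bullet> v) * g x)) (at x)"
    by (intro has_derivative_mult has_derivative_grad assms)
  from partial_eqI[OF this, of k] show ?thesis
    by (simp only: partial_grad[OF assms(1)] partial_grad[OF assms(2)])
qed

text \<open>The derivatives of \<open>\<phi>\<close> enter as explicit functions
  \<open>\<phi>1\<close> and \<open>\<phi>2\<close>, so that the chain rule can be applied twice;
  the second application differentiates the product
  \<open>\<phi>1 (f x) * partial l f x\<close>.\<close>

lemma
  fixes f :: "real^'n::finite \<Rightarrow> real"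
  assumes f: "C2 f"
    and d1: "\<And>s. (\<phi> has_real_derivative \<phi>1 s) (at s)"
    and d2: "\<And>s. (\<phi>1 has_real_derivative \<phi>2 s) (at s)"
    and c2: "continuous_on UNIV \<phi>2"
  shows C2_compose: "C2 (\<lambda>x. \<phi> (f x))"
    and partial2_compose: "partial k (partial l (\<lambda>x. \<phi> (f x))) x
      = \<phi>2 (f x) * (partial k f x * partial l f x) + \<phi>1 (f x) * partial k (partial l f) x"
proof -
  note fd = C2_differentiable[OF f] C2_partial_differentiable[OF f]
  have eq: "partial l (\<lambda>x. \<phi> (f x)) = (\<lambda>x. \<phi>1 (f x) * partial l f x)" for l
    using fd d1 by (intro ext partial_compose)
  have comp: "(\<lambda>x. \<psi> (f x)) differentiable (at x)" if "\<And>s. (\<psi> has_real_derivative \<psi>' s) (at s)" for \<psi> \<psi>' x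
  proof -
    have "\<psi> differentiable at (f x)"
      using that unfolding has_field_derivative_def differentiable_def by blast
    then show ?thesis using fd(1) by (rule differentiable_compose)
  qed
  have eq2: "partial k (\<lambda>x. \<phi>1 (f x) * partial l f x) x =
      \<phi>2 (f x) * (partial k f x * partial l f x) + \<phi>1 (f x) * partial k (partial l f) x" for k l x
    by (subst partial_mult[OF comp[OF d2] fd(2)])
       (simp add: partial_compose[OF fd(1) d2] algebra_simps)
  show "partial k (partial l (\<lambda>x. \<phi> (f x))) x
      = \<phi>2 (f x) * (partial k f x * partial l f x) + \<phi>1 (f x) * partial k (partial l f) x"
    unfolding eq eq2 ..
  have c: "continuous_on UNIV (\<lambda>x. \<phi>1 (f x))"
    using comp[OF d2] by (auto intro!: continuous_at_imp_continuous_on differentiable_imp_continuous_within)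
  have c': "continuous_on UNIV (\<lambda>x. \<phi>2 (f x))"
    by (rule continuous_on_compose2[OF c2 C2_continuous[OF f]]) auto
  show "C2 (\<lambda>x. \<phi> (f x))"
    unfolding C2_def
  proof (intro conjI allI)
    fix x show "(\<lambda>x. \<phi> (f x)) differentiable at x" by (rule comp[OF d1])
  next
    fix k x show "partial k (\<lambda>x. \<phi> (f x)) differentiable at x"
      unfolding eq using comp[OF d2] fd by (intro differentiable_mult)
  next
    fix k l
    show "continuous_on UNIV (partial k (partial l (\<lambda>x. \<phi> (f x))))"
      unfolding eq unfolding eq2[abs_def]
      by (intro continuous_intros c c' C2_partial_continuous C2_partial2_continuous f)
  qed
qed

text \<open>Polarization: a product is a quarter of the difference between the squares of the sum
  and of the difference. Closure under linear combinations and under composition with the square is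
  therefore enough.\<close>

lemma C2_mult:
  assumes "C2 f" "C2 g"
  shows "C2 (\<lambda>x. f x * g x)"
proof -
  have sq: "C2 (\<lambda>x. (1/4) * (h x)\<^sup>2)" if "C2 h" for h :: "real^'a \<Rightarrow> real"
    by (rule C2_compose[OF that, of _ "\<lambda>s. s / 2" "\<lambda>_. 1/2"]) (auto intro!: derivative_eq_intros)
  have "C2 (\<lambda>x. 1 * (1/4 * (1 * f x + 1 * g x)\<^sup>2) + (-1) * (1/4 * (1 * f x + (-1) * g x)\<^sup>2))"
    by (intro C2_linear_combination sq assms)
  moreover have "(\<lambda>x. 1 * (1/4 * (1 * f x + 1 * g x)\<^sup>2) + (-1) * (1/4 * (1 * f x + (-1) * g x)\<^sup>2))
     = (\<lambda>x. f x * g x)"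
    by (rule ext) (simp add: power2_eq_square field_simps)
  ultimately show ?thesis by simp
qed

lemma C2_add: "C2 f \<Longrightarrow> C2 g \<Longrightarrow> C2 (\<lambda>x. f x + g x)"
  using C2_linear_combination[of f g 1 1] by simp

lemma C2_const_minus: "C2 f \<Longrightarrow> C2 (\<lambda>x. c - f x)"
  using C2_linear_combination[OF C2_const[of 1], of f c "-1"] by simp

lemma partial_nth: "partial k (\<lambda>x. x $ l) x = (if k = l then 1 else 0)"
  by (rule partial_eqI[THEN trans, OF bounded_linear.has_derivative[OF bounded_linear_vec_nth has_derivative_ident]])
    (simp add: axis_def eq_commute)

lemma C2_nth: "C2 (\<lambda>x. x $ l)"
proof -
  have [simp]: "partial k (\<lambda>x::real^'a. x $ l) = (\<lambda>x. if k = l then 1 else 0)" for k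
    by (rule ext) (rule partial_nth)
  have [simp]: "partial k' (\<lambda>x. if k = l then 1 else 0) = (\<lambda>x::real^'a. 0)" for k k'
    by (cases "k = l") (auto simp: fun_eq_iff)
  show ?thesis
    by (auto simp: C2_def intro!: bounded_linear_imp_differentiable bounded_linear_vec_nth)
qed

lemma C2_sum: "finite I \<Longrightarrow> (\<And>i. i \<in> I \<Longrightarrow> C2 (f i)) \<Longrightarrow> C2 (\<lambda>x. \<Sum>i\<in>I. f i x)"
  by (induction I rule: finite_induct) (auto intro: C2_const C2_add)

lemma C2_norm_sq: "C2 (\<lambda>x::real^'n::finite. (norm x)\<^sup>2)"
proof -
  have "C2 (\<lambda>x::real^'n. \<Sum>k\<in>UNIV. x $ k * x $ k)"
    by (intro C2_sum C2_mult C2_nth) auto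
  then show ?thesis by (simp add: power2_norm_eq_inner inner_vec_def)
qed

section \<open>Truncation by powers of the positive part\<close>

lemma DERIV_pos_part_power:
  "((\<lambda>s::real. max 0 s ^ Suc (Suc n)) has_real_derivative real (Suc (Suc n)) * max 0 s ^ Suc n) (at s)"
proof -
  consider "s > 0" | "s < 0" | "s = 0" by linarith
  then show ?thesis
  proof cases
    case 1
    have "((\<lambda>s. s ^ Suc (Suc n)) has_real_derivative real (Suc (Suc n)) * max 0 s ^ Suc n) (at s)"
      using 1 DERIV_pow[of "Suc (Suc n)" s] by (simp add: max_def)
    then show ?thesis
      by (rule has_field_derivative_transform_within_open[of _ _ _ "{0<..}"]) (use 1 in \<open>auto simp: max_def\<close>)
  next
    case 2
    have "((\<lambda>s. 0) has_real_derivative real (Suc (Suc n)) * max 0 s ^ Suc n) (at s)"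
      using 2 by (auto simp: max_def)
    then show ?thesis
      by (rule has_field_derivative_transform_within_open[of _ _ _ "{..<0}"]) (use 2 in \<open>auto simp: max_def\<close>)
  next
    case 3
    \<comment> \<open>Only at 0 do the two branches meet; an exponent of at least 2 leaves a
      positive power of \<open>h\<close> in the difference quotient.\<close>
    have "((\<lambda>h::real. (max 0 h ^ Suc (Suc n)) / h) \<longlongrightarrow> 0) (at 0)"
    proof (rule Lim_null_comparison)
      show "\<forall>\<^sub>F h in at 0. norm (max 0 h ^ Suc (Suc n) / h) \<le> \<bar>h::real\<bar> ^ Suc n"
        by (intro always_eventually allI, rename_tac h, case_tac "0 \<le> h") (auto simp: max_def intro!: mult_nonpos_nonneg)
      have "((\<lambda>h::real. \<bar>h\<bar> ^ Suc n) \<longlongrightarrow> \<bar>0\<bar> ^ Suc n) (at 0)"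
        by (intro tendsto_intros)
      then show "((\<lambda>h::real. \<bar>h\<bar> ^ Suc n) \<longlongrightarrow> 0) (at 0)" by simp
    qed
    then show ?thesis using 3 by (simp add: DERIV_def)
  qed
qed

text \<open>Convexity of the cube of the positive part, in the tangent line form that later makes
  the truncation of \<open>V\<close> concave. For positive \<open>a\<close> and nonnegative
  \<open>b\<close> the gap factors as (b - a)^2 (b + 2 a); for negative \<open>b\<close> the tangent
  line is already below 0.\<close>

lemma pos_part_cube_tangent:
  fixes a b :: real
  shows "max 0 a ^ 3 + 3 * (max 0 a)\<^sup>2 * (b - a) \<le> max 0 b ^ 3"
proof -
  consider "a \<le> 0" | "0 < a" "0 \<le> b" | "0 < a" "b < 0" by linarith
  then show ?thesis
  proof cases
    case 2
    have "b ^ 3 - (a ^ 3 + 3 * a\<^sup>2 * (b - a)) = (b - a)\<^sup>2 * (b + 2 * a)"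
      by (simp add: power2_eq_square power3_eq_cube algebra_simps)
    also have "\<dots> \<ge> 0" using 2 by simp
    finally show ?thesis using 2 by simp
  next
    case 3
    have "a ^ 3 + 3 * a\<^sup>2 * (b - a) = 3 * a\<^sup>2 * b - 2 * a ^ 3"
      by (simp add: power2_eq_square power3_eq_cube algebra_simps)
    also have "\<dots> \<le> 0" using 3 by (simp add: mult_nonneg_nonpos order_trans[of _ 0])
    finally show ?thesis using 3 by simp
  qed simp
qed

lemma C2_pos_part_cube:
  assumes "C2 f" shows "C2 (\<lambda>x. max 0 (f x) ^ 3)"
proof (rule C2_compose[OF assms, of "\<lambda>s. max 0 s ^ 3" "\<lambda>s. 3 * max 0 s ^ 2" "\<lambda>s. 6 * max 0 s"])
  show "((\<lambda>s. max 0 s ^ 3) has_real_derivative 3 * (max 0 s)\<^sup>2) (at s)" for s :: real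
    using DERIV_pos_part_power[of 1 s] by (simp add: numeral_eq_Suc)
  show "((\<lambda>s. 3 * (max 0 s)\<^sup>2) has_real_derivative 6 * max 0 s) (at s)" for s :: real
    using DERIV_cmult[OF DERIV_pos_part_power[of 0 s], of 3] by (simp add: numeral_2_eq_2)
qed (intro continuous_intros)

text \<open>The derivatives up to order two vanish outside a slightly larger ball and are continuous
  on the compact remainder.\<close>

lemma C2_const_outside_C2b:
  assumes f: "C2 f" and out: "\<And>x. R \<le> norm x \<Longrightarrow> f x = c"
  shows "C2b f"
proof -
  have R: "partial k f x = 0" if "R < norm x" for k x
    using partial_eq_0_outside[OF out that] .
  \<comment> \<open>\<open>partial_eq_0_outside\<close> asks for a constant value on a closed
    exterior, while the first derivatives are known to vanish only for \<open>R < norm x\<close>;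
    enlarging the radius by 1 bridges this.\<close>
  have R2: "partial k (partial l f) x = 0" if "R + 1 < norm x" for k l x
  proof (rule partial_eq_0_outside[OF _ that])
    fix y :: "real^'a" assume "R + 1 \<le> norm y"
    then show "partial l f y = 0" by (intro R) simp
  qed
  have bd: "bounded (range h)" if "continuous_on UNIV h" "\<And>x. R' < norm x \<Longrightarrow> h x = d"
    for h :: "real^'a \<Rightarrow> real" and d R'
  proof -
    have "compact (h ` cball 0 R')"
      using that(1) by (intro compact_continuous_image compact_cball) (rule continuous_on_subset, auto)
    then have "bounded (insert d (h ` cball 0 R'))" by (simp add: compact_imp_bounded)
    moreover have "range h \<subseteq> insert d (h ` cball 0 R')"
    proof
      fix y assume "y \<in> range h"
      then obtain x where x: "y = h x" by auto
      show "y \<in> insert d (h ` cball 0 R')"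
        using that(2)[of x] x by (cases "R' < norm x") auto
    qed
    ultimately show ?thesis by (rule bounded_subset)
  qed
  show ?thesis unfolding C2b_def
  proof (intro conjI allI f)
    show "bounded (range f)"
      by (rule bd[OF C2_continuous[OF f], of R c]) (simp add: out)
    show "bounded (range (partial k f))" for k
      by (rule bd[OF C2_partial_continuous[OF f] R])
    show "bounded (range (partial k (partial l f)))" for k l
      by (rule bd[OF C2_partial2_continuous[OF f] R2])
  qed
qed

section \<open>The generator on functions constant outside a ball\<close>

lemma norm_grad_le:
  assumes "\<And>k. \<bar>partial k f x\<bar> \<le> B"
  shows "norm (grad f (x::real^'n::finite)) \<le> real CARD('n) * B"
proof -
  have "norm (grad f x) \<le> (\<Sum>k\<in>UNIV. \<bar>grad f x $ k\<bar>)" by (rule norm_le_l1_cart)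
  also have "\<dots> \<le> (\<Sum>k\<in>(UNIV::'n set). B)"
    by (rule sum_mono) (simp add: grad_def assms)
  finally show ?thesis by simp
qed

lemma differentiable_bound_grad:
  assumes "\<And>y. f differentiable (at y)" "\<And>y. norm (grad f y) \<le> B"
  shows "\<bar>f y - f x\<bar> \<le> B * norm (y - x)"
proof -
  have "norm (f y - f x) \<le> B * norm (y - x)"
  proof (rule differentiable_bound[of UNIV f "\<lambda>y v. grad f y \<bullet> v"])
    show "(f has_derivative (\<lambda>v. grad f y \<bullet> v)) (at y within UNIV)" for y
      using has_derivative_grad[OF assms(1)] .
    show "onorm (\<lambda>v. grad f y \<bullet> v) \<le> B" for y
    proof (rule onorm_le)
      fix v show "norm (grad f y \<bullet> v) \<le> B * norm v"
        using Cauchy_Schwarz_ineq2[of "grad f y" v] mult_right_mono[OF assms(2)[of y] norm_ge_zero[of v]]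
        by simp
    qed
  qed auto
  then show ?thesis by simp
qed

text \<open>The mean value inequality is applied twice. Bounded second derivatives make the gradient
  Lipschitz; then \<open>f\<close> minus its linear part at \<open>x\<close> has, on the ball of
  radius \<open>norm z\<close> around \<open>x\<close>, a derivative bounded by a multiple of
  \<open>norm z\<close>.\<close>

lemma C2b_taylor:
  fixes f :: "real^'n::finite \<Rightarrow> real"
  assumes f: "C2b f"
  obtains K where "0 \<le> K" "\<And>x z. \<bar>f (x + z) - f x - grad f x \<bullet> z\<bar> \<le> K * (norm z)\<^sup>2"
proof -
  have C2: "C2 f" using f by (simp add: C2b_def)
  have "\<exists>B. \<forall>x. \<bar>partial k (partial l f) x\<bar> \<le> B" for k l
    using f by (auto simp: C2b_def bounded_iff)
  then obtain B0 where B0: "\<And>k l x. \<bar>partial k (partial l f) x\<bar> \<le> B0 k l" by metis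
  define B where "B = (\<Sum>k\<in>UNIV. \<Sum>l\<in>UNIV. \<bar>B0 k l\<bar>)"
  have B: "\<bar>partial k (partial l f) x\<bar> \<le> B" for k l x
  proof -
    have "\<bar>partial k (partial l f) x\<bar> \<le> \<bar>B0 k l\<bar>" using B0[of k l x] by linarith
    also have "\<dots> \<le> (\<Sum>l\<in>UNIV. \<bar>B0 k l\<bar>)" by (rule member_le_sum) auto
    also have "\<dots> \<le> B" unfolding B_def
      by (rule member_le_sum[where f="\<lambda>k. \<Sum>l\<in>UNIV. \<bar>B0 k l\<bar>"]) (auto intro: sum_nonneg)
    finally show ?thesis .
  qed
  let ?n = "real CARD('n)"
  have B_nonneg: "0 \<le> B" by (auto simp: B_def intro!: sum_nonneg)
  have lip: "\<bar>partial k f y - partial k f x\<bar> \<le> ?n * B * norm (y - x)" for k x y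
    by (rule differentiable_bound_grad[OF C2_partial_differentiable[OF C2] norm_grad_le[OF B]])
  have lip2: "norm (grad f y - grad f x) \<le> ?n * (?n * B * norm (y - x))" for x y
  proof -
    have "norm (grad f y - grad f x) \<le> (\<Sum>k\<in>UNIV. \<bar>(grad f y - grad f x) $ k\<bar>)" by (rule norm_le_l1_cart)
    also have "\<dots> \<le> (\<Sum>k\<in>(UNIV::'n set). ?n * B * norm (y - x))"
      using lip by (intro sum_mono) (simp add: grad_def)
    finally show ?thesis by simp
  qed
  have "\<bar>f (x + z) - f x - grad f x \<bullet> z\<bar> \<le> (?n * (?n * B)) * (norm z)\<^sup>2" for x z
  proof -
    let ?e = "\<lambda>y. f y - grad f x \<bullet> y"
    have "norm (?e (x + z) - ?e x) \<le> (?n * (?n * B * norm z)) * norm ((x + z) - x)"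
    proof (rule differentiable_bound[of "cball x (norm z)" ?e "\<lambda>y v. grad f y \<bullet> v - grad f x \<bullet> v"])
      fix y assume y: "y \<in> cball x (norm z)"
      show "(?e has_derivative (\<lambda>v. grad f y \<bullet> v - grad f x \<bullet> v)) (at y within cball x (norm z))"
        by (rule has_derivative_at_withinI)
          (intro has_derivative_diff has_derivative_grad C2_differentiable[OF C2]
            bounded_linear_imp_has_derivative bounded_linear_inner_right)
      show "onorm (\<lambda>v. grad f y \<bullet> v - grad f x \<bullet> v) \<le> ?n * (?n * B * norm z)"
      proof (rule onorm_le)
        fix v
        have "norm (grad f y \<bullet> v - grad f x \<bullet> v) \<le> norm (grad f y - grad f x) * norm v"
          using Cauchy_Schwarz_ineq2[of "grad f y - grad f x" v] by (simp add: inner_diff_left)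
        also have "norm (grad f y - grad f x) \<le> ?n * (?n * B * norm z)"
          using lip2[of y x] y B_nonneg
          by (elim order_trans) (auto intro!: mult_left_mono simp: dist_norm norm_minus_commute)
        finally show "norm (grad f y \<bullet> v - grad f x \<bullet> v) \<le> ?n * (?n * B * norm z) * norm v"
          by (simp add: mult_right_mono)
      qed
    qed (auto simp: dist_norm)
    then show ?thesis by (simp add: inner_add_right power2_eq_square algebra_simps)
  qed
  then show ?thesis using B_nonneg by (intro that[of "?n * (?n * B)"]) auto
qed

text \<open>Taylor's bound covers jumps in the unit ball, where the gradient is compensated; for
  larger jumps the integrand is a difference of two values of \<open>f\<close>. The two terms match
  the two moment assumptions on the jump kernel.\<close>

lemma C2b_jump_integrand_bound:
  assumes f: "C2b f"
  obtains K S where "0 \<le> K" "0 \<le> S"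
    "\<And>x z. \<bar>jump_integrand f x z\<bar> \<le> K * ((norm z)\<^sup>2 * indicator (ball 0 1) z) + S * indicator (- ball 0 1) z"
proof -
  obtain K where K: "0 \<le> K" "\<And>x z. \<bar>f (x + z) - f x - grad f x \<bullet> z\<bar> \<le> K * (norm z)\<^sup>2"
    using C2b_taylor[OF f] by metis
  obtain S where S: "\<And>x. \<bar>f x\<bar> \<le> S" using f by (auto simp: C2b_def bounded_iff)
  have "\<bar>jump_integrand f x z\<bar> \<le> K * ((norm z)\<^sup>2 * indicator (ball 0 1) z) + (2 * S) * indicator (- ball 0 1) z" for x z
    using K(2)[of x z] S[of "x + z"] S[of x] by (auto simp: jump_integrand_def indicator_def)
  moreover have "0 \<le> 2 * S" using S[of 0] by linarith
  ultimately show ?thesis using that K(1) by blast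
qed

lemma borel_measurable_jump_integrand [measurable]:
  assumes "continuous_on UNIV f"
  shows "jump_integrand f x \<in> borel_measurable borel"
proof -
  have "continuous_on UNIV (\<lambda>z. f (x + z))"
    by (rule continuous_on_compose2[OF assms]) (auto intro!: continuous_intros)
  then have [measurable]: "(\<lambda>z. f (x + z)) \<in> borel_measurable borel"
    by (rule borel_measurable_continuous_onI)
  show ?thesis unfolding jump_integrand_def[abs_def] by measurable
qed

lemma bounded_if_continuous_eventually_0:
  fixes h :: "real^'n \<Rightarrow> real"
  assumes "continuous_on UNIV h" "\<And>x. R < norm x \<Longrightarrow> h x = 0"
  obtains B where "\<And>x. \<bar>h x\<bar> \<le> B"
proof -
  have "compact (h ` cball 0 R)"
    by (intro compact_continuous_image compact_cball) (rule continuous_on_subset[OF assms(1)], auto)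
  then obtain B where B: "\<forall>x\<in>cball 0 R. \<bar>h x\<bar> \<le> B"
    by (auto dest!: compact_imp_bounded simp: bounded_iff)
  have "\<bar>h x\<bar> \<le> \<bar>B\<bar>" for x
    using B[rule_format, of x] assms(2)[of x] by (cases "norm x \<le> R") auto
  then show ?thesis using that by blast
qed

lemma jump_integrand_linear_combination:
  assumes "C2 f" "C2 g"
  shows "jump_integrand (\<lambda>x. \<alpha> * f x + \<beta> * g x) x = (\<lambda>z. \<alpha> * jump_integrand f x z + \<beta> * jump_integrand g x z)"
proof -
  have "grad (\<lambda>x. \<alpha> * f x + \<beta> * g x) x = \<alpha> *\<^sub>R grad f x + \<beta> *\<^sub>R grad g x"
    using assms by (simp add: vec_eq_iff grad_def partial_linear_combination C2_differentiable)
  then show ?thesis by (auto simp: jump_integrand_def fun_eq_iff inner_add_left algebra_simps)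
qed

text \<open>Integrability is assumed because the Bochner integral is additive only on integrable
  functions.\<close>

lemma generator_linear_combination:
  assumes "\<And>i. C2 (\<lambda>x. f x i)" "\<And>i. C2 (\<lambda>x. g x i)"
    and "integrable (\<pi> i x) (jump_integrand (\<lambda>y. f y i) x)"
    and "integrable (\<pi> i x) (jump_integrand (\<lambda>y. g y i) x)"
  shows "generator b \<sigma> \<pi> Q (\<lambda>x i. \<alpha> * f x i + \<beta> * g x i) x i
    = \<alpha> * generator b \<sigma> \<pi> Q f x i + \<beta> * generator b \<sigma> \<pi> Q g x i"
  using assms
  by (simp add: generator_def jump_integrand_linear_combination partial_linear_combination
      partial2_linear_combination C2_differentiable sum.distrib sum_distrib_left algebra_simps)

section \<open>Moment bounds for the jump kernel and estimates for the generator\<close>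

context regime_switching_jump_diffusion
begin

lemma sets_jump_measure [measurable_cong]: "sets (\<pi> i x) = sets borel"
  using levy by (simp add: levy_measure_def)

lemma big_jumps_bound:
  obtains K where "0 \<le> K" "\<And>i x. emeasure (\<pi> i x) (- ball 0 1) \<le> ennreal K"
proof -
  let ?S = "SUP (x, i)\<in>UNIV. emeasure (\<pi> i x) (- ball 0 1)"
  have "emeasure (\<pi> i x) (- ball 0 1) \<le> ?S" for i x
    by (rule SUP_upper2[of "(x, i)"]) auto
  then show ?thesis using that[of "enn2real ?S"] big_jumps by simp
qed

lemma small_jumps_bound:
  obtains c where "c > 0"
    "\<And>i x. (\<integral>\<^sup>+z\<in>ball 0 1. ennreal ((norm z)\<^sup>2) \<partial>\<pi> i x) \<le> ennreal (c * (1 + (norm x)\<^sup>2))"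
proof -
  obtain c where c: "c > 0" "\<And>x. (SUP i. \<integral>\<^sup>+z\<in>ball 0 1. ennreal ((norm z)\<^sup>2) \<partial>\<pi> i x) \<le> ennreal (c * (1 + (norm x)\<^sup>2))"
    using small_jumps by blast
  have "(\<integral>\<^sup>+z\<in>ball 0 1. ennreal ((norm z)\<^sup>2) \<partial>\<pi> i x) \<le> ennreal (c * (1 + (norm x)\<^sup>2))" for i x
    by (rule order_trans[OF _ c(2)]) (rule SUP_upper, simp)
  then show ?thesis using that c(1) by blast
qed

lemma nn_integral_jump_bound:
  assumes "0 \<le> A" "0 \<le> B"
  shows "(\<integral>\<^sup>+z. ennreal (A * ((norm z)\<^sup>2 * indicator (ball 0 1) z) + B * indicator (- ball 0 1) z) \<partial>\<pi> i x)
    = ennreal A * (\<integral>\<^sup>+z\<in>ball 0 1. ennreal ((norm z)\<^sup>2) \<partial>\<pi> i x) + ennreal B * emeasure (\<pi> i x) (- ball 0 1)"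
proof -
  have [measurable]: "- ball 0 1 \<in> sets (\<pi> i x)" "ball 0 1 \<in> sets (\<pi> i x)"
    unfolding sets_jump_measure by auto
  have [measurable]: "(\<lambda>z. ennreal ((norm z)\<^sup>2)) \<in> borel_measurable (\<pi> i x)"
    unfolding measurable_cong_sets[OF sets_jump_measure refl] by measurable
  have "(\<integral>\<^sup>+z. ennreal (A * ((norm z)\<^sup>2 * indicator (ball 0 1) z) + B * indicator (- ball 0 1) z) \<partial>\<pi> i x)
    = (\<integral>\<^sup>+z. ennreal A * (ennreal ((norm z)\<^sup>2) * indicator (ball 0 1) z) + ennreal B * indicator (- ball 0 1) z \<partial>\<pi> i x)"
    using assms by (intro nn_integral_cong) (auto simp: indicator_def ennreal_mult)
  also have "\<dots> = ennreal A * (\<integral>\<^sup>+z\<in>ball 0 1. ennreal ((norm z)\<^sup>2) \<partial>\<pi> i x) + ennreal B * emeasure (\<pi> i x) (- ball 0 1)"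
    by (subst nn_integral_add) (auto simp: nn_integral_cmult)
  finally show ?thesis .
qed

text \<open>Keeping the small-jump and big-jump constants apart allows \<open>A = 0\<close>, which
  is used where jumps shorter than 1 leave the function unchanged.\<close>

lemma jump_integral_bound:
  assumes f: "continuous_on UNIV f" and "0 \<le> A" "0 \<le> B" "0 \<le> C" "0 \<le> D"
    and le: "\<And>z. \<bar>jump_integrand f x z\<bar> \<le> A * ((norm z)\<^sup>2 * indicator (ball 0 1) z) + B * indicator (- ball 0 1) z"
    and C: "(\<integral>\<^sup>+z\<in>ball 0 1. ennreal ((norm z)\<^sup>2) \<partial>\<pi> i x) \<le> ennreal C"
    and D: "emeasure (\<pi> i x) (- ball 0 1) \<le> ennreal D"
  shows integrable_jump_integrand: "integrable (\<pi> i x) (jump_integrand f x)"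
    and "\<bar>\<integral>z. jump_integrand f x z \<partial>\<pi> i x\<bar> \<le> A * C + B * D"
proof -
  note [measurable] = borel_measurable_jump_integrand[OF f]
  have "(\<integral>\<^sup>+z. ennreal (norm (jump_integrand f x z)) \<partial>\<pi> i x) \<le>
     (\<integral>\<^sup>+z. ennreal (A * ((norm z)\<^sup>2 * indicator (ball 0 1) z) + B * indicator (- ball 0 1) z) \<partial>\<pi> i x)"
    using le by (intro nn_integral_mono ennreal_leI) auto
  also have "\<dots> \<le> ennreal A * ennreal C + ennreal B * ennreal D"
    unfolding nn_integral_jump_bound[OF assms(2,3)] using C D by (intro add_mono mult_left_mono) auto
  also have "\<dots> = ennreal (A * C + B * D)"
    using assms by (simp add: ennreal_mult ennreal_plus)
  finally have *: "(\<integral>\<^sup>+z. ennreal (norm (jump_integrand f x z)) \<partial>\<pi> i x) \<le> ennreal (A * C + B * D)" .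
  show int: "integrable (\<pi> i x) (jump_integrand f x)"
    by (rule integrableI_bounded) (use * in \<open>auto intro: le_less_trans\<close>)
  have "norm (\<integral>z. jump_integrand f x z \<partial>\<pi> i x) \<le> (\<integral>z. norm (jump_integrand f x z) \<partial>\<pi> i x)"
    by (rule integral_norm_bound)
  also have "\<dots> \<le> A * C + B * D"
    using * nn_integral_eq_integral[OF integrable_norm[OF int]] assms(2-5)
    by (simp add: ennreal_le_iff flip: ennreal_plus)
  finally show "\<bar>\<integral>z. jump_integrand f x z \<partial>\<pi> i x\<bar> \<le> A * C + B * D" by simp
qed

lemma C2b_integrable_jump_integrand:
  assumes "C2b f"
  shows "integrable (\<pi> i x) (jump_integrand f x)"
proof -
  obtain K S where "0 \<le> K" "0 \<le> S"
    "\<And>x z. \<bar>jump_integrand f x z\<bar> \<le> K * ((norm z)\<^sup>2 * indicator (ball 0 1) z) + S * indicator (- ball 0 1) z"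
    using C2b_jump_integrand_bound[OF assms] by metis
  moreover obtain c where "c > 0" "\<And>i x. (\<integral>\<^sup>+z\<in>ball 0 1. ennreal ((norm z)\<^sup>2) \<partial>\<pi> i x) \<le> ennreal (c * (1 + (norm x)\<^sup>2))"
    using small_jumps_bound by metis
  moreover obtain D where "0 \<le> D" "\<And>i x. emeasure (\<pi> i x) (- ball 0 1) \<le> ennreal D"
    using big_jumps_bound by metis
  ultimately show ?thesis
    using assms by (intro integrable_jump_integrand[of f K S "c * (1 + (norm x)\<^sup>2)" D])
      (auto simp: C2b_def intro: C2_continuous)
qed

text \<open>The coefficients may grow, but the local terms vanish outside a bounded set, and the
  switching term is a sum of products of bounded functions. The small-jump moment is used only on a
  bounded set: farther out, jumps shorter than 1 stay where the function is constant, and the mass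
  of the remaining jumps is uniformly bounded.\<close>

lemma generator_bounded:
  fixes f :: "real^'n \<Rightarrow> 'm \<Rightarrow> real"
  assumes C2: "\<And>i. C2 (\<lambda>x. f x i)" and out: "\<And>x i. R \<le> norm x \<Longrightarrow> f x i = c i"
  shows "\<exists>C\<ge>0. \<forall>x i. \<bar>generator b \<sigma> \<pi> Q f x i\<bar> \<le> C"
proof -
  have C2b: "C2b (\<lambda>x. f x i)" for i using C2_const_outside_C2b[OF C2 out] .
  have p1: "partial k (\<lambda>x. f x i) x = 0" if "R < norm x" for k x i
    using partial_eq_0_outside[OF out that] .
  have p2: "partial k (partial l (\<lambda>x. f x i)) x = 0" if "R + 1 < norm x" for k l x i
  proof (rule partial_eq_0_outside[OF _ that])
    fix y :: "real^'n" assume "R + 1 \<le> norm y"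
    then show "partial l (\<lambda>x. f x i) y = 0" by (intro p1) simp
  qed
  define L where "L x i = (1/2) * (\<Sum>k\<in>UNIV. \<Sum>l\<in>UNIV.
        diffusion_matrix \<sigma> x i $ k $ l * partial k (partial l (\<lambda>y. f y i)) x)
     + (\<Sum>k\<in>UNIV. b x i $ k * partial k (\<lambda>y. f y i) x)" for x i
  have cL: "continuous_on UNIV (\<lambda>x. L x i)" for i
    unfolding L_def diffusion_matrix_def matrix_matrix_mult_def transpose_def
    by (simp, intro continuous_intros ballI zero_neq_numeral[symmetric] sigma_continuous b_continuous
        C2_partial_continuous[OF C2] C2_partial2_continuous[OF C2])
  have zL: "L x i = 0" if "R + 1 < norm x" for x i
    using that by (simp add: L_def p1 p2)
  have "\<exists>B. \<forall>x. \<bar>L x i\<bar> \<le> B" for i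
    using bounded_if_continuous_eventually_0[OF cL zL] by metis
  then obtain BL where BL: "\<And>x i. \<bar>L x i\<bar> \<le> BL i" by metis

  have "\<exists>B. \<forall>x. \<bar>Q x $ i $ j * f x j\<bar> \<le> B" for i j
  proof -
    obtain B1 where B1: "\<And>x. \<bar>Q x $ i $ j\<bar> \<le> B1"
      using Q_bounded[of i j] by (auto simp: bounded_iff)
    obtain B2 where B2: "\<And>x. \<bar>f x j\<bar> \<le> B2"
      using C2b[of j] by (auto simp: C2b_def bounded_iff)
    have "0 \<le> B1" using B1[of 0] by linarith
    then have "\<bar>Q x $ i $ j * f x j\<bar> \<le> B1 * B2" for x
      unfolding abs_mult using B1[of x] B2[of x] by (intro mult_mono) auto
    then show ?thesis by blast
  qed
  then obtain BQ where BQ: "\<And>x i j. \<bar>Q x $ i $ j * f x j\<bar> \<le> BQ i j" by metis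

  obtain c0 where c0: "c0 > 0"
    "\<And>i x. (\<integral>\<^sup>+z\<in>ball 0 1. ennreal ((norm z)\<^sup>2) \<partial>\<pi> i x) \<le> ennreal (c0 * (1 + (norm x)\<^sup>2))"
    using small_jumps_bound by metis
  obtain D where D: "0 \<le> D" "\<And>i x. emeasure (\<pi> i x) (- ball 0 1) \<le> ennreal D"
    using big_jumps_bound by metis
  have "\<exists>B. \<forall>x. \<bar>\<integral>z. jump_integrand (\<lambda>y. f y i) x z \<partial>\<pi> i x\<bar> \<le> B" for i
  proof -
    obtain K S where KS: "0 \<le> K" "0 \<le> S" "\<And>x z. \<bar>jump_integrand (\<lambda>y. f y i) x z\<bar> \<le>
        K * ((norm z)\<^sup>2 * indicator (ball 0 1) z) + S * indicator (- ball 0 1) z"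
      using C2b_jump_integrand_bound[OF C2b] by metis
    have cont: "continuous_on UNIV (\<lambda>y. f y i)" by (rule C2_continuous[OF C2])
    have "\<bar>\<integral>z. jump_integrand (\<lambda>y. f y i) x z \<partial>\<pi> i x\<bar> \<le> K * (c0 * (1 + (\<bar>R\<bar> + 1)\<^sup>2)) + S * D" for x
    proof (cases "norm x < \<bar>R\<bar> + 1")
      case True
      have "\<bar>\<integral>z. jump_integrand (\<lambda>y. f y i) x z \<partial>\<pi> i x\<bar> \<le> K * (c0 * (1 + (norm x)\<^sup>2)) + S * D"
        using c0 D KS by (intro jump_integral_bound[OF cont]) auto
      also have "\<dots> \<le> K * (c0 * (1 + (\<bar>R\<bar> + 1)\<^sup>2)) + S * D"
        using True c0 KS by (intro add_mono mult_left_mono power_mono) auto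
      finally show ?thesis .
    next
      case False
      have "\<bar>jump_integrand (\<lambda>y. f y i) x z\<bar> \<le>
        0 * ((norm z)\<^sup>2 * indicator (ball 0 1) z) + S * indicator (- ball 0 1) z" for z
      proof (cases "z \<in> ball 0 1")
        case True
        have "R < norm x" using False by linarith
        then have g: "grad (\<lambda>y. f y i) x = 0" by (simp add: grad_def p1 vec_eq_iff)
        have "R \<le> norm (x + z)" using norm_triangle_ineq2[of x "- z"] True False by auto
        moreover have "R \<le> norm x" using False by linarith
        ultimately show ?thesis using True by (simp add: jump_integrand_def g out)
      next
        case F: False
        then show ?thesis using KS(3)[of x z] by simp
      qed
      \<comment> \<open>With the coefficient 0 in front of the small-jump moment, its growth in
        \<open>x\<close> drops out.\<close>
      then have "\<bar>\<integral>z. jump_integrand (\<lambda>y. f y i) x z \<partial>\<pi> i x\<bar> \<le> 0 * (c0 * (1 + (norm x)\<^sup>2)) + S * D"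
        using c0 D KS by (intro jump_integral_bound[OF cont]) auto
      also have "\<dots> \<le> K * (c0 * (1 + (\<bar>R\<bar> + 1)\<^sup>2)) + S * D"
        using c0 KS by simp
      finally show ?thesis .
    qed
    then show ?thesis by blast
  qed
  then obtain BJ where BJ: "\<And>x i. \<bar>\<integral>z. jump_integrand (\<lambda>y. f y i) x z \<partial>\<pi> i x\<bar> \<le> BJ i" by metis
  define C where "C = (\<Sum>i\<in>UNIV. \<bar>BL i\<bar> + \<bar>BJ i\<bar> + (\<Sum>j\<in>UNIV. \<bar>BQ i j\<bar>))"
  have "\<bar>generator b \<sigma> \<pi> Q f x i\<bar> \<le> C" for x i
  proof -
    have "\<bar>\<Sum>j\<in>UNIV. Q x $ i $ j * f x j\<bar> \<le> (\<Sum>j\<in>UNIV. \<bar>BQ i j\<bar>)"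
      by (rule order_trans[OF sum_abs]) (intro sum_mono order_trans[OF BQ] abs_ge_self)
    moreover have "generator b \<sigma> \<pi> Q f x i = L x i + (\<integral>z. jump_integrand (\<lambda>y. f y i) x z \<partial>\<pi> i x)
        + (\<Sum>j\<in>UNIV. Q x $ i $ j * f x j)"
      by (simp add: generator_def L_def)
    ultimately have "\<bar>generator b \<sigma> \<pi> Q f x i\<bar> \<le> \<bar>BL i\<bar> + \<bar>BJ i\<bar> + (\<Sum>j\<in>UNIV. \<bar>BQ i j\<bar>)"
      using BL[of x i] BJ[of i x] by linarith
    also have "\<dots> \<le> C" unfolding C_def
      by (rule member_le_sum[where f = "\<lambda>i. \<bar>BL i\<bar> + \<bar>BJ i\<bar> + (\<Sum>j\<in>UNIV. \<bar>BQ i j\<bar>)"])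
        (auto intro!: add_nonneg_nonneg sum_nonneg)
    finally show ?thesis .
  qed
  moreover have "0 \<le> C" by (auto simp: C_def intro!: sum_nonneg add_nonneg_nonneg)
  ultimately show ?thesis by blast
qed

text \<open>Each part of the generator obeys the chain rule up to an error of the right sign. The
  second-order part leaves \<open>\<phi>2\<close> times a nonnegative quadratic form; for jumps and
  switching the tangent line inequality takes the place of the derivative.\<close>

lemma generator_concave_compose_le:
  fixes V :: "real^'n \<Rightarrow> 'm \<Rightarrow> real"
  assumes V: "\<And>i. C2 (\<lambda>x. V x i)"
    and d1: "\<And>s. (\<phi> has_real_derivative \<phi>1 s) (at s)"
    and d2: "\<And>s. (\<phi>1 has_real_derivative \<phi>2 s) (at s)"
    and c2: "continuous_on UNIV \<phi>2"
    and nonpos: "\<And>s. \<phi>2 s \<le> 0"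
    and tangent: "\<And>s t. \<phi> t \<le> \<phi> s + \<phi>1 s * (t - s)"
    and int: "integrable (\<pi> i x) (jump_integrand (\<lambda>y. V y i) x)"
    and int\<phi>: "integrable (\<pi> i x) (jump_integrand (\<lambda>y. \<phi> (V y i)) x)"
  shows "generator b \<sigma> \<pi> Q (\<lambda>x i. \<phi> (V x i)) x i \<le> \<phi>1 (V x i) * generator b \<sigma> \<pi> Q V x i"
proof -
  let ?v = "\<lambda>y. V y i" and ?a = "diffusion_matrix \<sigma> x i"
  let ?w = "\<phi>1 (V x i)"
  have p1: "partial k (\<lambda>y. \<phi> (V y i)) x = ?w * partial k ?v x" for k
    by (rule partial_compose[OF C2_differentiable[OF V] d1])
  have p2: "partial k (partial l (\<lambda>y. \<phi> (V y i))) x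
     = \<phi>2 (V x i) * (partial k ?v x * partial l ?v x) + ?w * partial k (partial l ?v) x" for k l
    by (rule partial2_compose[OF V d1 d2 c2])
  have quad: "0 \<le> (\<Sum>k\<in>UNIV. \<Sum>l\<in>UNIV. ?a $ k $ l * (partial k ?v x * partial l ?v x))"
  proof -
    \<comment> \<open>Since the diffusion matrix is \<open>\<sigma>\<close> times its transpose, the
      form is the squared norm of the transpose applied to the gradient.\<close>
    have "(\<Sum>k\<in>UNIV. \<Sum>l\<in>UNIV. ?a $ k $ l * (partial k ?v x * partial l ?v x))
       = (\<Sum>k\<in>UNIV. \<Sum>l\<in>UNIV. \<Sum>r\<in>UNIV. (\<sigma> x i $ k $ r * partial k ?v x) * (\<sigma> x i $ l $ r * partial l ?v x))"
      by (simp add: diffusion_matrix_def matrix_matrix_mult_def transpose_def sum_distrib_left sum_distrib_right mult_ac)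
    also have "\<dots> = (\<Sum>k\<in>UNIV. \<Sum>r\<in>UNIV. \<Sum>l\<in>UNIV. (\<sigma> x i $ k $ r * partial k ?v x) * (\<sigma> x i $ l $ r * partial l ?v x))"
      by (intro sum.cong refl sum.swap)
    also have "\<dots> = (\<Sum>r\<in>UNIV. \<Sum>k\<in>UNIV. \<Sum>l\<in>UNIV. (\<sigma> x i $ k $ r * partial k ?v x) * (\<sigma> x i $ l $ r * partial l ?v x))"
      by (rule sum.swap)
    also have "\<dots> = (\<Sum>r\<in>UNIV. (\<Sum>k\<in>UNIV. \<sigma> x i $ k $ r * partial k ?v x)\<^sup>2)"
      by (simp add: power2_eq_square sum_product)
    also have "\<dots> \<ge> 0" by (intro sum_nonneg) auto
    finally show ?thesis .
  qed
  have diff: "(\<Sum>k\<in>UNIV. \<Sum>l\<in>UNIV. ?a $ k $ l * partial k (partial l (\<lambda>y. \<phi> (V y i))) x)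
     \<le> ?w * (\<Sum>k\<in>UNIV. \<Sum>l\<in>UNIV. ?a $ k $ l * partial k (partial l ?v) x)"
  proof -
    have "(\<Sum>k\<in>UNIV. \<Sum>l\<in>UNIV. ?a $ k $ l * partial k (partial l (\<lambda>y. \<phi> (V y i))) x)
      = \<phi>2 (V x i) * (\<Sum>k\<in>UNIV. \<Sum>l\<in>UNIV. ?a $ k $ l * (partial k ?v x * partial l ?v x))
        + ?w * (\<Sum>k\<in>UNIV. \<Sum>l\<in>UNIV. ?a $ k $ l * partial k (partial l ?v) x)"
      unfolding p2 by (simp add: sum_distrib_left sum.distrib distrib_left mult_ac)
    moreover have "\<phi>2 (V x i) * (\<Sum>k\<in>UNIV. \<Sum>l\<in>UNIV. ?a $ k $ l * (partial k ?v x * partial l ?v x)) \<le> 0"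
      using quad nonpos by (intro mult_nonpos_nonneg) auto
    ultimately show ?thesis by linarith
  qed
  have drift: "(\<Sum>k\<in>UNIV. b x i $ k * partial k (\<lambda>y. \<phi> (V y i)) x) = ?w * (\<Sum>k\<in>UNIV. b x i $ k * partial k ?v x)"
    unfolding p1 by (simp add: sum_distrib_left mult_ac)
  have jump: "(\<integral>z. jump_integrand (\<lambda>y. \<phi> (V y i)) x z \<partial>\<pi> i x) \<le> ?w * (\<integral>z. jump_integrand ?v x z \<partial>\<pi> i x)"
  proof -
    have g: "grad (\<lambda>y. \<phi> (V y i)) x = ?w *\<^sub>R grad ?v x" by (simp add: grad_def p1 vec_eq_iff)
    have "jump_integrand (\<lambda>y. \<phi> (V y i)) x z \<le> ?w * jump_integrand ?v x z" for z
      using tangent[of "V (x + z) i" "V x i"] by (simp add: jump_integrand_def g algebra_simps)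
    then have "(\<integral>z. jump_integrand (\<lambda>y. \<phi> (V y i)) x z \<partial>\<pi> i x) \<le> (\<integral>z. ?w * jump_integrand ?v x z \<partial>\<pi> i x)"
      using int int\<phi> by (intro integral_mono) auto
    then show ?thesis by simp
  qed
  have switch: "(\<Sum>j\<in>UNIV. Q x $ i $ j * \<phi> (V x j)) \<le> ?w * (\<Sum>j\<in>UNIV. Q x $ i $ j * V x j)"
  proof -
    \<comment> \<open>Zero row sums allow the value in regime \<open>i\<close> to be subtracted; the
      diagonal term then vanishes and only nonnegative rates remain.\<close>
    have shift: "(\<Sum>j\<in>UNIV. Q x $ i $ j * u j) = (\<Sum>j\<in>UNIV. Q x $ i $ j * (u j - u i))" for u
      using Q_row_sum[of x i] by (simp add: right_diff_distrib sum_subtractf flip: sum_distrib_right)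
    have "(\<Sum>j\<in>UNIV. Q x $ i $ j * (\<phi> (V x j) - \<phi> (V x i))) \<le> (\<Sum>j\<in>UNIV. Q x $ i $ j * (?w * (V x j - V x i)))"
    proof (rule sum_mono)
      fix j
      show "Q x $ i $ j * (\<phi> (V x j) - \<phi> (V x i)) \<le> Q x $ i $ j * (?w * (V x j - V x i))"
        using tangent[of "V x j" "V x i"] Q_nonneg[of i j x]
        by (cases "i = j") (auto intro!: mult_left_mono)
    qed
    also have "\<dots> = ?w * (\<Sum>j\<in>UNIV. Q x $ i $ j * (V x j - V x i))"
      by (simp add: sum_distrib_left mult_ac)
    finally show ?thesis
      using shift[of "\<lambda>j. \<phi> (V x j)"] shift[of "V x"] by simp
  qed
  show ?thesis
    unfolding generator_def distrib_left
    using diff drift jump switch by simp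
qed

end

section \<open>Measurability on the path space\<close>

lemma space_state_space [simp]: "space state_space = UNIV"
  by (simp add: state_space_def space_pair_measure)

lemma measurable_fst_state_space [measurable]: "fst \<in> state_space \<rightarrow>\<^sub>M borel"
  and measurable_snd_state_space [measurable]: "snd \<in> state_space \<rightarrow>\<^sub>M count_space UNIV"
  unfolding state_space_def by measurable

lemma measurable_regime_function:
  fixes f :: "real^'n::finite \<Rightarrow> 'm::finite \<Rightarrow> real"
  assumes "\<And>i. (\<lambda>x. f x i) \<in> borel_measurable borel"
  shows "(\<lambda>p. f (fst p) (snd p)) \<in> borel_measurable state_space"
proof (rule measurable_compose_countable'[where f = "\<lambda>i p. f (fst p) i" and I = UNIV])
  fix i
  show "(\<lambda>p. f (fst p) i) \<in> borel_measurable state_space"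
    by (rule measurable_compose[OF measurable_fst_state_space assms])
qed (auto intro: countable_finite)

lemma space_skorohod_cadlag: "\<omega> \<in> space skorohod_space \<Longrightarrow> cadlag \<omega>"
  by (simp add: skorohod_space_def space_restrict_space)

lemma measurable_coordinate_skorohod:
  assumes "0 \<le> s"
  shows "(\<lambda>\<omega>. \<omega> s) \<in> skorohod_space \<rightarrow>\<^sub>M state_space"
  unfolding skorohod_space_def
  using assms by (intro measurable_restrict_space1 measurable_component_singleton) simp

lemma space_path_filtration [simp]: "space (path_filtration t) = space skorohod_space"
  by (simp add: path_filtration_def)

lemma measurable_coordinate_filtration:
  assumes "0 \<le> s" "s \<le> t"
  shows "(\<lambda>\<omega>. \<omega> s) \<in> path_filtration t \<rightarrow>\<^sub>M state_space"
proof -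
  have "(\<lambda>\<omega>. restrict \<omega> {0..t}) \<in> path_filtration t \<rightarrow>\<^sub>M (\<Pi>\<^sub>M s\<in>{0..t}. state_space)"
    unfolding path_filtration_def
    by (rule measurable_vimage_algebra1) (auto simp: space_PiM)
  moreover have "(\<lambda>\<omega>. \<omega> s) \<in> (\<Pi>\<^sub>M s\<in>{0..t}. state_space) \<rightarrow>\<^sub>M state_space"
    using assms by (intro measurable_component_singleton) auto
  ultimately have "(\<lambda>\<omega>. restrict \<omega> {0..t} s) \<in> path_filtration t \<rightarrow>\<^sub>M state_space"
    by (rule measurable_compose)
  then show ?thesis using assms by simp
qed

text \<open>Minimality of the generated sigma-algebra; monotonicity of the filtration and its
  inclusion in the sigma-algebra of the path space are both instances.\<close>

lemma sets_path_filtration_subset: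
  assumes "space N = space skorohod_space"
    and "\<And>s. 0 \<le> s \<Longrightarrow> s \<le> t \<Longrightarrow> (\<lambda>\<omega>. \<omega> s) \<in> N \<rightarrow>\<^sub>M state_space"
  shows "sets (path_filtration t) \<subseteq> sets N"
  unfolding path_filtration_def
proof (rule sets_image_in_sets[OF assms(1)])
  show "(\<lambda>\<omega>. restrict \<omega> {0..t}) \<in> N \<rightarrow>\<^sub>M Pi\<^sub>M {0..t} (\<lambda>s. state_space)"
    using assms(2) by (intro measurable_restrict) auto
qed

lemma sets_path_filtration_mono: "s \<le> t \<Longrightarrow> sets (path_filtration s) \<subseteq> sets (path_filtration t)"
  by (rule sets_path_filtration_subset) (auto intro: measurable_coordinate_filtration)

lemma sets_path_filtration_skorohod: "sets (path_filtration t) \<subseteq> sets skorohod_space"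
  by (rule sets_path_filtration_subset) (auto intro: measurable_coordinate_skorohod)

text \<open>The two alternatives are those that occur for grid points truncated at a final time:
  before that time the approach is strictly from the right, and at that time the sequence is
  constant.\<close>

lemma cadlag_tendsto_right:
  assumes c: "cadlag \<omega>" and t: "0 \<le> t" and r: "r \<longlonglongrightarrow> t"
    and ev: "(\<forall>k::nat. t < r k) \<or> (\<forall>\<^sub>F k in sequentially. r k = t)"
  shows "(\<lambda>k. fst (\<omega> (r k))) \<longlonglongrightarrow> fst (\<omega> t)"
    and "\<forall>\<^sub>F k in sequentially. snd (\<omega> (r k)) = snd (\<omega> t)"
proof -
  have "((\<lambda>k. fst (\<omega> (r k))) \<longlonglongrightarrow> fst (\<omega> t)) \<and> (\<forall>\<^sub>F k in sequentially. snd (\<omega> (r k)) = snd (\<omega> t))"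
    using ev
  proof
    assume "\<forall>k. t < r k"
    then have f: "filterlim r (at_right t) sequentially"
      using r by (auto simp: filterlim_at less_imp_neq[symmetric])
    have c': "((\<lambda>s. fst (\<omega> s)) \<longlongrightarrow> fst (\<omega> t)) (at_right t)" "\<forall>\<^sub>F s in at_right t. snd (\<omega> s) = snd (\<omega> t)"
      using c t by (auto simp: cadlag_def)
    show ?thesis
      using filterlim_compose[OF c'(1) f] eventually_compose_filterlim[OF c'(2) f] by simp
  next
    assume *: "\<forall>\<^sub>F k in sequentially. r k = t"
    then show ?thesis
      by (auto intro!: tendsto_eventually elim: eventually_mono)
  qed
  then show "(\<lambda>k. fst (\<omega> (r k))) \<longlonglongrightarrow> fst (\<omega> t)"
    and "\<forall>\<^sub>F k in sequentially. snd (\<omega> (r k)) = snd (\<omega> t)" by auto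
qed

text \<open>The path at time \<open>r\<close> is approximated by its values at grid points to the right of \<open>r\<close>,
  truncated at \<open>t\<close> so that only the coordinates in $[0,t]$ are used.\<close>

lemma progressively_measurable:
  fixes N :: "(real \<Rightarrow> (real^'n::finite) \<times> 'm::finite) measure"
  assumes sp: "space N = space skorohod_space" and t: "0 \<le> t"
    and coord: "\<And>s. 0 \<le> s \<Longrightarrow> s \<le> t \<Longrightarrow> (\<lambda>\<omega>. \<omega> s) \<in> N \<rightarrow>\<^sub>M state_space"
  shows "(\<lambda>p. fst p (max 0 (min t (snd p)))) \<in> N \<Otimes>\<^sub>M borel \<rightarrow>\<^sub>M state_space"
proof -
  define c where "c r = max 0 (min t r)" for r :: real
  define g where "g k r = min t ((of_int \<lfloor>c r * real (Suc k)\<rfloor> + 1) / real (Suc k))" for k r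
  have c: "0 \<le> c r" "c r \<le> t" for r using t by (auto simp: c_def)
  have gt: "c r < (of_int \<lfloor>c r * real (Suc k)\<rfloor> + 1) / real (Suc k)" for k r
    by (simp add: less_divide_eq del: of_nat_Suc)
  have le: "(of_int \<lfloor>c r * real (Suc k)\<rfloor> + 1) / real (Suc k) \<le> c r + 1 / real (Suc k)" for k r
    by (simp add: divide_le_eq add_divide_distrib distrib_right del: of_nat_Suc)
  have g_lim: "(\<lambda>k. g k r) \<longlonglongrightarrow> c r" for r
  proof (rule tendsto_sandwich[of "\<lambda>_. c r" _ _ "\<lambda>k. c r + 1 / real (Suc k)"])
    show "\<forall>\<^sub>F k in sequentially. c r \<le> g k r"
      using gt c by (auto simp: g_def less_imp_le)
    show "\<forall>\<^sub>F k in sequentially. g k r \<le> c r + 1 / real (Suc k)"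
      using le by (auto simp: g_def min_le_iff_disj)
    show "(\<lambda>k. c r + 1 / real (Suc k)) \<longlonglongrightarrow> c r"
      using tendsto_add[OF tendsto_const LIMSEQ_inverse_real_of_nat, of "c r"] by (simp add: inverse_eq_divide)
  qed simp
  have g_ev: "(\<forall>k. c r < g k r) \<or> (\<forall>\<^sub>F k in sequentially. g k r = c r)" for r
  proof (cases "c r = t")
    case True
    then have "g k r = c r" for k using gt[of r k] by (simp add: g_def)
    then show ?thesis by simp
  next
    case False
    then have "c r < t" using c[of r] by simp
    then show ?thesis using gt by (simp add: g_def)
  qed
  have [measurable]: "c \<in> borel_measurable borel" unfolding c_def by measurable
  have g_meas: "(\<lambda>p. fst p (g k (snd p))) \<in> N \<Otimes>\<^sub>M borel \<rightarrow>\<^sub>M state_space" for k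
  proof -
    \<comment> \<open>For a fixed index \<open>j\<close> the time is deterministic; the outer
      \<open>max 0\<close> keeps it in \<open>{0..t}\<close> also for indices that are never
      attained.\<close>
    let ?f = "\<lambda>(j::int) (p::(real \<Rightarrow> (real^'n) \<times> 'm) \<times> real). fst p (max 0 (min t ((of_int j + 1) / real (Suc k))))"
    have "(\<lambda>p. ?f \<lfloor>c (snd p) * real (Suc k)\<rfloor> p) \<in> N \<Otimes>\<^sub>M borel \<rightarrow>\<^sub>M state_space"
    proof (rule measurable_compose_countable[where f = ?f and g = "\<lambda>p. \<lfloor>c (snd p) * real (Suc k)\<rfloor>"])
      show "?f j \<in> N \<Otimes>\<^sub>M borel \<rightarrow>\<^sub>M state_space" for j
        by (rule measurable_compose[OF measurable_fst coord]) (use t in auto)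
      show "(\<lambda>p. \<lfloor>c (snd p) * real (Suc k)\<rfloor>) \<in> N \<Otimes>\<^sub>M borel \<rightarrow>\<^sub>M count_space UNIV"
        by measurable
    qed
    moreover have "max 0 (min t ((of_int \<lfloor>c r * real (Suc k)\<rfloor> + 1) / real (Suc k))) = g k r" for r
      using gt[of r k] c[of r] t unfolding g_def by linarith
    ultimately show ?thesis by simp
  qed
  have lim: "(\<lambda>k. fst (\<omega> (g k r))) \<longlonglongrightarrow> fst (\<omega> (c r))"
      "\<forall>\<^sub>F k in sequentially. snd (\<omega> (g k r)) = snd (\<omega> (c r))" if "\<omega> \<in> space N" for \<omega> r
    using cadlag_tendsto_right[OF space_skorohod_cadlag _ g_lim g_ev, of \<omega> r] that c[of r] sp by auto
  have 1: "(\<lambda>p. fst (fst p (c (snd p)))) \<in> borel_measurable (N \<Otimes>\<^sub>M borel)"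
  proof (rule borel_measurable_LIMSEQ_metric)
    show "(\<lambda>p. fst (fst p (g k (snd p)))) \<in> borel_measurable (N \<Otimes>\<^sub>M borel)" for k
      by (rule measurable_compose[OF g_meas measurable_fst_state_space])
    show "(\<lambda>k. fst (fst p (g k (snd p)))) \<longlonglongrightarrow> fst (fst p (c (snd p)))" if "p \<in> space (N \<Otimes>\<^sub>M borel)" for p
      using lim(1)[of "fst p" "snd p"] that by (auto simp: space_pair_measure)
  qed
  have 2: "(\<lambda>p. snd (fst p (c (snd p)))) \<in> N \<Otimes>\<^sub>M borel \<rightarrow>\<^sub>M count_space UNIV"
  proof (rule measurable_count_space_eq_countable[OF countable_finite[OF finite], THEN iffD2], intro conjI ballI)
    fix j :: 'm
    \<comment> \<open>Eventual equality along integers \<open>k\<close> expresses the event by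
      countable unions and intersections.\<close>
    have eq: "snd (\<omega> (c r)) = j \<longleftrightarrow> (\<exists>K. \<forall>k\<ge>K. snd (\<omega> (g k r)) = j)" if "\<omega> \<in> space N" for \<omega> r
    proof -
      have "snd (\<omega> (c r)) = j \<longleftrightarrow> (\<forall>\<^sub>F k in sequentially. snd (\<omega> (g k r)) = j)"
      proof
        show "\<forall>\<^sub>F k in sequentially. snd (\<omega> (g k r)) = j" if "snd (\<omega> (c r)) = j"
          using lim(2)[OF \<open>\<omega> \<in> space N\<close>, of r] that by simp
        assume "\<forall>\<^sub>F k in sequentially. snd (\<omega> (g k r)) = j"
        then have "\<forall>\<^sub>F k in sequentially. snd (\<omega> (c r)) = j"
          using lim(2)[OF \<open>\<omega> \<in> space N\<close>, of r] by eventually_elim simp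
        then show "snd (\<omega> (c r)) = j" by simp
      qed
      then show ?thesis by (simp add: eventually_sequentially)
    qed
    have [measurable]: "(\<lambda>p. snd (fst p (g k (snd p)))) \<in> N \<Otimes>\<^sub>M borel \<rightarrow>\<^sub>M count_space UNIV" for k
      by (rule measurable_compose[OF g_meas measurable_snd_state_space])
    have "(\<lambda>p. snd (fst p (c (snd p)))) -` {j} \<inter> space (N \<Otimes>\<^sub>M borel)
      = {p \<in> space (N \<Otimes>\<^sub>M borel). \<exists>K. \<forall>k\<ge>K. snd (fst p (g k (snd p))) = j}"
    proof (rule set_eqI)
      fix p
      show "p \<in> (\<lambda>p. snd (fst p (c (snd p)))) -` {j} \<inter> space (N \<Otimes>\<^sub>M borel)
        \<longleftrightarrow> p \<in> {p \<in> space (N \<Otimes>\<^sub>M borel). \<exists>K. \<forall>k\<ge>K. snd (fst p (g k (snd p))) = j}"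
        using eq[of "fst p" "snd p"] by (auto simp only: space_pair_measure mem_Times_iff vimage_eq Int_iff singleton_iff mem_Collect_eq)
    qed
    also have "\<dots> \<in> sets (N \<Otimes>\<^sub>M borel)" by measurable
    finally show "(\<lambda>p. snd (fst p (c (snd p)))) -` {j} \<inter> space (N \<Otimes>\<^sub>M borel) \<in> sets (N \<Otimes>\<^sub>M borel)" .
  qed simp
  have "(\<lambda>p. (fst (fst p (c (snd p))), snd (fst p (c (snd p))))) \<in> N \<Otimes>\<^sub>M borel \<rightarrow>\<^sub>M state_space"
    unfolding state_space_def by (rule measurable_Pair[OF 1 2])
  then show ?thesis by (simp add: c_def)
qed

text \<open>Right-continuity keeps the path in the open set for a short time after a hit, and that
  interval contains a rational. Through this, never hitting \<open>D\<close> is an event.\<close>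

lemma cadlag_hits_open_iff_rational:
  assumes c: "cadlag \<omega>" and D: "open D"
  shows "(\<exists>t\<ge>0. fst (\<omega> t) \<in> D) \<longleftrightarrow> (\<exists>q\<in>\<rat>. 0 \<le> q \<and> fst (\<omega> q) \<in> D)"
proof
  assume "\<exists>t\<ge>0. fst (\<omega> t) \<in> D"
  then obtain t where t: "0 \<le> t" "fst (\<omega> t) \<in> D" by auto
  have "((\<lambda>s. fst (\<omega> s)) \<longlongrightarrow> fst (\<omega> t)) (at_right t)" using c t by (auto simp: cadlag_def)
  then have "\<forall>\<^sub>F s in at_right t. fst (\<omega> s) \<in> D" using D t(2) by (rule topological_tendstoD)
  then obtain u where u: "u > t" "\<And>s. t < s \<Longrightarrow> s < u \<Longrightarrow> fst (\<omega> s) \<in> D"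
    by (auto simp: eventually_at_right_field)
  obtain q where "q \<in> \<rat>" "t < q" "q < u" using Rats_dense_in_real[OF u(1)] by auto
  then show "\<exists>q\<in>\<rat>. 0 \<le> q \<and> fst (\<omega> q) \<in> D" using u t by force
qed auto

lemma sets_never_hits:
  assumes D: "open (D :: (real^'n::finite) set)" and P: "sets P = sets (skorohod_space :: (real \<Rightarrow> (real^'n) \<times> 'm::finite) measure)"
  shows "{\<omega> \<in> space P. \<forall>t\<ge>0. fst (\<omega> t) \<notin> D} \<in> sets P"
proof -
  have sp: "space P = space skorohod_space" using P by (rule sets_eq_imp_space_eq)
  have [measurable]: "D \<in> sets borel" using D by simp
  have "{\<omega> \<in> space P. fst (\<omega> q) \<in> D} \<in> sets P" if "0 \<le> q" for q
  proof -
    have [measurable]: "(\<lambda>\<omega>. \<omega> q) \<in> P \<rightarrow>\<^sub>M state_space"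
      using measurable_coordinate_skorohod[OF that] by (simp add: measurable_cong_sets[OF P refl])
    show ?thesis by measurable
  qed
  then have "(\<Union>q\<in>{q\<in>\<rat>. 0 \<le> q}. {\<omega> \<in> space P. fst (\<omega> q) \<in> D}) \<in> sets P"
    using countable_rat by (intro sets.countable_UN') (auto intro: countable_subset)
  then have "space P - (\<Union>q\<in>{q\<in>\<rat>. 0 \<le> q}. {\<omega> \<in> space P. fst (\<omega> q) \<in> D}) \<in> sets P"
    by auto
  also have "space P - (\<Union>q\<in>{q\<in>\<rat>. 0 \<le> q}. {\<omega> \<in> space P. fst (\<omega> q) \<in> D}) =
    {\<omega> \<in> space P. \<forall>t\<ge>0. fst (\<omega> t) \<notin> D}"
    using cadlag_hits_open_iff_rational[OF space_skorohod_cadlag D] sp by blast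
  finally show ?thesis .
qed

section \<open>Killed supersolutions\<close>

text \<open>Cut the interval into equal steps: with \<open>n\<close> of them the accumulated error
  is K t^2 / n. A second-order one-step estimate thus replaces differentiation in time.\<close>

lemma antimono_if_quadratic_increments:
  fixes \<Phi> :: "real \<Rightarrow> real"
  assumes inc: "\<And>s t. 0 \<le> s \<Longrightarrow> s \<le> t \<Longrightarrow> \<Phi> t \<le> \<Phi> s + K * (t - s)\<^sup>2" and t: "0 \<le> t"
  shows "\<Phi> t \<le> \<Phi> 0"
proof -
  have steps: "\<Phi> (real j * h) \<le> \<Phi> 0 + real j * (K * h\<^sup>2)" if "0 \<le> h" for j h
  proof (induction j)
    case (Suc j)
    have "\<Phi> (real (Suc j) * h) \<le> \<Phi> (real j * h) + K * (real (Suc j) * h - real j * h)\<^sup>2"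
      using that by (intro inc mult_right_mono) auto
    also have "real (Suc j) * h - real j * h = h" by (simp add: algebra_simps)
    finally show ?case using Suc by (simp add: algebra_simps)
  qed simp
  have "\<Phi> t \<le> \<Phi> 0 + K * t\<^sup>2 * inverse (real (Suc n))" for n
  proof -
    have 1: "real (Suc n) * (t / real (Suc n)) = t" by (simp del: of_nat_Suc)
    have 2: "real (Suc n) * (K * (t / real (Suc n))\<^sup>2) = K * t\<^sup>2 * inverse (real (Suc n))"
      by (simp add: power2_eq_square field_simps del: of_nat_Suc)
    show ?thesis using steps[of "t / real (Suc n)" "Suc n"] t unfolding 1 2 by simp
  qed
  moreover have "(\<lambda>n. \<Phi> 0 + K * t\<^sup>2 * inverse (real (Suc n))) \<longlonglongrightarrow> \<Phi> 0 + K * t\<^sup>2 * 0"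
    by (intro tendsto_intros LIMSEQ_inverse_real_of_nat)
  ultimately show ?thesis by (intro LIMSEQ_le_const) (auto intro!: exI[of _ 0])
qed

lemma exp_minus_le_quadratic:
  assumes "0 \<le> (a::real)" shows "exp (- a) \<le> 1 - a + a\<^sup>2 / 2"
proof -
  let ?f = "\<lambda>a::real. 1 - a + a\<^sup>2 / 2 - exp (- a)"
  have "?f 0 \<le> ?f a"
  proof (rule DERIV_nonneg_imp_nondecreasing[OF assms])
    fix x :: real
    have "(?f has_real_derivative (x - 1 + exp (- x))) (at x)"
      by (auto intro!: derivative_eq_intros)
    moreover have "0 \<le> x - 1 + exp (- x)" using exp_ge_add_one_self[of "- x"] by simp
    ultimately show "\<exists>y. (?f has_real_derivative y) (at x) \<and> 0 \<le> y" by blast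
  qed
  then show ?thesis by simp
qed

lemma set_integral_increment:
  fixes f :: "real \<Rightarrow> real"
  assumes "set_integrable lborel {0..t} f" "0 \<le> s" "s \<le> t"
  shows "(LINT r:{0..t}|lborel. f r) - (LINT r:{0..s}|lborel. f r) = (LINT r:{s<..t}|lborel. f r)"
proof -
  have "{0..t} = {0..s} \<union> {s<..t}" using assms by auto
  moreover have "(LINT r:{0..s} \<union> {s<..t}|lborel. f r) = (LINT r:{0..s}|lborel. f r) + (LINT r:{s<..t}|lborel. f r)"
    using assms by (intro set_integral_Un set_integrable_subset[OF assms(1)]) auto
  ultimately show ?thesis by simp
qed

lemma set_integral_const_Ioc: "s \<le> t \<Longrightarrow> (LINT r:{s<..t}|lborel. (c::real)) = c * (t - s)"
  by (simp add: set_lebesgue_integral_def)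

lemma set_integrable_const_Ioc: "s \<le> t \<Longrightarrow> set_integrable lborel {s<..t :: real} (\<lambda>r. c :: real)"
  unfolding set_integrable_def by (rule integrableI_bounded_set_indicator[where B = "\<bar>c\<bar>"]) auto

text \<open>The form in which the martingale property is used: testing against a bounded weight
  known at the earlier time.\<close>

lemma (in prob_space) integral_mult_cond_exp_eq:
  fixes X Y Z :: "'a \<Rightarrow> real"
  assumes F: "subalgebra M F" and X: "integrable M X" and Z: "integrable M Z"
    and Y: "Y \<in> borel_measurable F" and bd: "\<And>\<omega>. \<omega> \<in> space M \<Longrightarrow> \<bar>Y \<omega>\<bar> \<le> B"
    and ce: "AE \<omega> in M. real_cond_exp M F X \<omega> = Z \<omega>"
  shows "(\<integral>\<omega>. Y \<omega> * X \<omega> \<partial>M) = (\<integral>\<omega>. Y \<omega> * Z \<omega> \<partial>M)"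
proof -
  interpret finite_measure_subalgebra M F by unfold_locales (rule F)
  have YM: "Y \<in> borel_measurable M" by (rule measurable_from_subalg[OF F Y])
  have "integrable M (\<lambda>\<omega>. Y \<omega> * X \<omega>)"
  proof (rule Bochner_Integration.integrable_bound[OF integrable_mult_right[OF integrable_abs[OF X], of B]])
    show "AE \<omega> in M. norm (Y \<omega> * X \<omega>) \<le> norm (B * \<bar>X \<omega>\<bar>)"
      by (rule AE_I2) (auto simp: abs_mult intro!: mult_right_mono order_trans[OF bd])
  qed (use YM X in measurable)
  then have "(\<integral>\<omega>. Y \<omega> * X \<omega> \<partial>M) = (\<integral>\<omega>. Y \<omega> * real_cond_exp M F X \<omega> \<partial>M)"
    using real_cond_exp_intg(2)[OF _ Y borel_measurable_integrable[OF X]] by simp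
  also have "\<dots> = (\<integral>\<omega>. Y \<omega> * Z \<omega> \<partial>M)"
    using YM Z ce by (intro integral_cong_AE) auto
  finally show ?thesis .
qed

lemma solves_martingale_problem_initial:
  assumes "solves_martingale_problem b \<sigma> \<pi> Q x i P"
  shows "AE \<omega> in P. \<omega> 0 = (x, i)"
proof -
  interpret prob_space P using assms by (simp add: solves_martingale_problem_def)
  have 1: "prob {\<omega> \<in> space P. \<omega> 0 = (x, i)} = 1"
    using assms by (simp add: solves_martingale_problem_def)
  \<comment> \<open>\<open>measure\<close> is 0 on sets that are not measurable, so the value 1
    forces this set to be an event.\<close>
  have "{\<omega> \<in> space P. \<omega> 0 = (x, i)} \<in> events"
  proof (rule ccontr)
    assume "{\<omega> \<in> space P. \<omega> 0 = (x, i)} \<notin> events"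
    from measure_notin_sets[OF this] 1 show False by simp
  qed
  from AE_in_set_eq_1[OF this] 1 show ?thesis by auto
qed

text \<open>The function \<open>g\<close> stands for $\mathcal{G}W$; it is not assumed measurable, since the standing
  assumptions give no joint measurability of the jump kernel in $x$.\<close>

locale killed_supersolution = prob_space P
  for P :: "(real \<Rightarrow> (real^'n::finite) \<times> 'm::finite) measure" +
  fixes W g :: "real^'n \<Rightarrow> 'm \<Rightarrow> real" and \<rho> :: "real^'n \<Rightarrow> real" and D :: "(real^'n) set"
    and S C \<Lambda> :: real
  assumes sets_P: "sets P = sets skorohod_space"
    and W_continuous: "\<And>i. continuous_on UNIV (\<lambda>x. W x i)"
    and W_bounds: "\<And>x i. 0 \<le> W x i" "\<And>x i. W x i \<le> S"
    and g_bound: "\<And>x i. \<bar>g x i\<bar> \<le> C"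
    and \<rho>_measurable: "\<rho> \<in> borel_measurable borel"
    and \<rho>_bounds: "\<And>x. 0 \<le> \<rho> x" "\<And>x. \<rho> x \<le> \<Lambda>"
    and open_D: "open D"
    and supersolution: "\<And>x i. g x i - \<rho> x * W x i \<le> - (\<rho> x * indicator (- D) x)"
    and g_integrable: "AE \<omega> in P. \<forall>t\<ge>0. set_integrable lborel {0..t} (\<lambda>s. g (fst (\<omega> s)) (snd (\<omega> s)))"
    and martingale: "is_martingale P path_filtration
       (\<lambda>t \<omega>. W (fst (\<omega> t)) (snd (\<omega> t)) - W (fst (\<omega> 0)) (snd (\<omega> 0))
          - (LINT s:{0..t}|lborel. g (fst (\<omega> s)) (snd (\<omega> s))))"
begin

definition w :: "real \<Rightarrow> (real \<Rightarrow> (real^'n) \<times> 'm) \<Rightarrow> real" where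
  "w t \<omega> = W (fst (\<omega> t)) (snd (\<omega> t))"
definition k :: "real \<Rightarrow> (real \<Rightarrow> (real^'n) \<times> 'm) \<Rightarrow> real" where
  "k t \<omega> = \<rho> (fst (\<omega> t))"
definition I where "I t \<omega> = (LINT s:{0..t}|lborel. g (fst (\<omega> s)) (snd (\<omega> s)))"
text \<open>The accumulated killing rate: \<open>exp (- A t \<omega>)\<close> is the survival weight
  at time \<open>t\<close>.\<close>

definition A where "A t \<omega> = (LINT s:{0..t}|lborel. k s \<omega>)"
definition avoid where "avoid = {\<omega> \<in> space P. \<forall>t\<ge>0. fst (\<omega> t) \<notin> D}"

section \<open>Measurability and increments of the killing functional and the compensator\<close>

lemma space_P: "space P = space skorohod_space"
  using sets_P by (rule sets_eq_imp_space_eq)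

lemma avoid_event [measurable]: "avoid \<in> events"
  unfolding avoid_def by (rule sets_never_hits[OF open_D sets_P])

lemma coordinate_P: "0 \<le> s \<Longrightarrow> (\<lambda>\<omega>. \<omega> s) \<in> P \<rightarrow>\<^sub>M state_space"
  using measurable_coordinate_skorohod by (simp add: measurable_cong_sets[OF sets_P refl])

lemma subalg_P: "subalgebra P (path_filtration t)"
  using sets_path_filtration_skorohod[of t] by (auto simp: subalgebra_def space_P sets_P)

lemma W_state_measurable: "(\<lambda>p. W (fst p) (snd p)) \<in> borel_measurable state_space"
  by (rule measurable_regime_function[OF borel_measurable_continuous_onI[OF W_continuous]])

lemma \<rho>_state_measurable: "(\<lambda>p. \<rho> (fst p)) \<in> borel_measurable state_space"
  by (rule measurable_compose[OF measurable_fst_state_space \<rho>_measurable])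

lemma k_measurable_F: "0 \<le> s \<Longrightarrow> s \<le> t \<Longrightarrow> k s \<in> borel_measurable (path_filtration t)"
  unfolding k_def by (rule measurable_compose[OF measurable_coordinate_filtration \<rho>_state_measurable])

lemma w_measurable: "0 \<le> s \<Longrightarrow> w s \<in> borel_measurable P"
  unfolding w_def by (rule measurable_compose[OF coordinate_P W_state_measurable])

lemma w_bounds: "0 \<le> w t \<omega>" "w t \<omega> \<le> S" and k_bounds: "0 \<le> k t \<omega>" "k t \<omega> \<le> \<Lambda>"
  by (simp_all add: w_def k_def W_bounds \<rho>_bounds)

lemma progressive:
  assumes "space N = space skorohod_space" "0 \<le> t"
    and "\<And>s. 0 \<le> s \<Longrightarrow> s \<le> t \<Longrightarrow> (\<lambda>\<omega>. \<omega> s) \<in> N \<rightarrow>\<^sub>M state_space"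
  shows "(\<lambda>p. w (max 0 (min t (snd p))) (fst p)) \<in> borel_measurable (N \<Otimes>\<^sub>M borel)"
    and "(\<lambda>p. k (max 0 (min t (snd p))) (fst p)) \<in> borel_measurable (N \<Otimes>\<^sub>M borel)"
  using measurable_compose[OF progressively_measurable[OF assms] W_state_measurable]
    measurable_compose[OF progressively_measurable[OF assms] \<rho>_state_measurable]
  by (simp_all add: w_def k_def)

lemma progressive_P:
  assumes "0 \<le> t"
  shows "(\<lambda>p. w (max 0 (min t (snd p))) (fst p)) \<in> borel_measurable (P \<Otimes>\<^sub>M borel)"
    and "(\<lambda>p. k (max 0 (min t (snd p))) (fst p)) \<in> borel_measurable (P \<Otimes>\<^sub>M borel)"
    and "(\<lambda>p. fst p (max 0 (min t (snd p)))) \<in> P \<Otimes>\<^sub>M borel \<rightarrow>\<^sub>M state_space"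
  using progressive[OF space_P assms coordinate_P] progressively_measurable[OF space_P assms coordinate_P]
  by auto

text \<open>Evaluated at clamped times, the path functions are sections of jointly measurable
  functions. Clamping has no effect on the interval of integration, and boundedness gives
  integrability.\<close>

lemma path_set_integrable:
  assumes \<omega>: "\<omega> \<in> space P" and s: "0 \<le> s"
  shows "set_integrable lborel {s..t} (\<lambda>r. k r \<omega>)"
    and "set_integrable lborel {s..t} (\<lambda>r. k r \<omega> * w r \<omega>)"
    and "set_integrable lborel {s..t} (\<lambda>r. k r \<omega> * indicator (- D) (fst (\<omega> r)))"
proof -
  let ?t = "max 0 t"
  have [measurable]: "(\<lambda>r. w (max 0 (min ?t r)) \<omega>) \<in> borel_measurable lborel"
    using measurable_compose[OF measurable_Pair1'[OF \<omega>] progressive_P(1)[of ?t]] by simp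
  have [measurable]: "(\<lambda>r. k (max 0 (min ?t r)) \<omega>) \<in> borel_measurable lborel"
    using measurable_compose[OF measurable_Pair1'[OF \<omega>] progressive_P(2)[of ?t]] by simp
  have "(\<lambda>r. \<omega> (max 0 (min ?t r))) \<in> borel \<rightarrow>\<^sub>M state_space"
    using measurable_compose[OF measurable_Pair1'[OF \<omega>] progressive_P(3)[of ?t]]
    by simp
  then have X: "(\<lambda>r. fst (\<omega> (max 0 (min ?t r)))) \<in> borel_measurable borel"
    by (rule measurable_compose[OF _ measurable_fst_state_space])
  have "indicat_real (- D) \<in> borel_measurable borel" using open_D by simp
  from measurable_compose[OF X this]
  have [measurable]: "(\<lambda>r. indicat_real (- D) (fst (\<omega> (max 0 (min ?t r))))) \<in> borel_measurable lborel" by simp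
  have *: "set_integrable lborel {s..t} f"
    if m: "(\<lambda>r. f (max 0 (min ?t r))) \<in> borel_measurable lborel" and b: "\<And>r. \<bar>f r\<bar> \<le> B" for f :: "real \<Rightarrow> real" and B
  proof -
    have "integrable lborel (\<lambda>r. indicator {s..t} r *\<^sub>R f (max 0 (min ?t r)))"
      using m b by (intro integrableI_bounded_set_indicator[where B = B]) (auto simp: emeasure_lborel_Icc_eq)
    moreover have "(\<lambda>r. indicator {s..t} r *\<^sub>R f (max 0 (min ?t r))) = (\<lambda>r. indicator {s..t} r *\<^sub>R f r)"
      using s by (auto simp: fun_eq_iff indicator_def)
    ultimately show ?thesis by (simp add: set_integrable_def)
  qed
  show "set_integrable lborel {s..t} (\<lambda>r. k r \<omega>)"
  proof (rule *[of _ \<Lambda>])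
    show "\<bar>k r \<omega>\<bar> \<le> \<Lambda>" for r using k_bounds[of r \<omega>] by simp
  qed measurable
  show "set_integrable lborel {s..t} (\<lambda>r. k r \<omega> * w r \<omega>)"
  proof (rule *[of _ "\<Lambda> * S"])
    show "\<bar>k r \<omega> * w r \<omega>\<bar> \<le> \<Lambda> * S" for r
      using k_bounds[of r \<omega>] w_bounds[of r \<omega>] by (auto simp: abs_mult intro!: mult_mono)
  qed measurable
  show "set_integrable lborel {s..t} (\<lambda>r. k r \<omega> * indicator (- D) (fst (\<omega> r)))"
  proof (rule *[of _ \<Lambda>])
    show "\<bar>k r \<omega> * indicator (- D) (fst (\<omega> r))\<bar> \<le> \<Lambda>" for r
      using k_bounds[of r \<omega>] by (auto simp: indicator_def)
  qed measurable
qed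

text \<open>Progressive measurability up to \<open>t\<close>, together with measurability of
  parameter integrals, makes \<open>A\<close> adapted; hence \<open>exp (- A s \<omega>)\<close> is
  an admissible weight at time \<open>s\<close>.\<close>

lemma A_measurable_F: "0 \<le> t \<Longrightarrow> A t \<in> borel_measurable (path_filtration t)"
proof -
  assume t: "0 \<le> t"
  have [measurable]: "(\<lambda>p. k (max 0 (min t (snd p))) (fst p)) \<in> borel_measurable (path_filtration t \<Otimes>\<^sub>M borel)"
    using progressive(2)[of "path_filtration t" t, OF space_path_filtration t measurable_coordinate_filtration] by auto
  have "(\<lambda>\<omega>. \<integral>r. indicator {0..t} r * k (max 0 (min t r)) \<omega> \<partial>lborel) \<in> borel_measurable (path_filtration t)"
    by (rule lborel.borel_measurable_lebesgue_integral) (simp add: split_beta', measurable)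
  moreover have "A t = (\<lambda>\<omega>. \<integral>r. indicator {0..t} r * k (max 0 (min t r)) \<omega> \<partial>lborel)"
    unfolding A_def set_lebesgue_integral_def
    by (intro ext Bochner_Integration.integral_cong) (auto simp: indicator_def)
  ultimately show ?thesis by simp
qed

lemma A_measurable: "0 \<le> t \<Longrightarrow> A t \<in> borel_measurable P"
  by (rule measurable_from_subalg[OF subalg_P A_measurable_F])

lemma A_increment:
  assumes \<omega>: "\<omega> \<in> space P" and st: "0 \<le> s" "s \<le> t"
  shows "A t \<omega> - A s \<omega> = (LINT r:{s<..t}|lborel. k r \<omega>)"
    and "0 \<le> A t \<omega> - A s \<omega>" and "A t \<omega> - A s \<omega> \<le> \<Lambda> * (t - s)"
    and "(\<And>x. \<eta> \<le> \<rho> x) \<Longrightarrow> \<eta> * (t - s) \<le> A t \<omega> - A s \<omega>"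
proof -
  show eq: "A t \<omega> - A s \<omega> = (LINT r:{s<..t}|lborel. k r \<omega>)"
    unfolding A_def by (rule set_integral_increment[OF path_set_integrable(1)[OF \<omega>]]) (use st in auto)
  have int: "set_integrable lborel {s<..t} (\<lambda>r. k r \<omega>)"
    by (rule set_integrable_subset[OF path_set_integrable(1)[OF \<omega> order_refl, of t]]) (use st in auto)
  have intc: "set_integrable lborel {s<..t} (\<lambda>r. c)" for c :: real
    by (rule set_integrable_const_Ioc[OF st(2)])
  show "0 \<le> A t \<omega> - A s \<omega>"
    unfolding eq using set_integral_mono[OF intc[of 0] int k_bounds(1)] by (simp add: set_integral_const_Ioc[OF st(2)])
  show "A t \<omega> - A s \<omega> \<le> \<Lambda> * (t - s)"
    unfolding eq using set_integral_mono[OF int intc[of \<Lambda>] k_bounds(2)] by (simp add: set_integral_const_Ioc[OF st(2)])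
  show "\<eta> * (t - s) \<le> A t \<omega> - A s \<omega>" if "\<And>x. \<eta> \<le> \<rho> x"
    unfolding eq using set_integral_mono[OF intc[of \<eta>] int] that by (simp add: set_integral_const_Ioc[OF st(2)] k_def)
qed

lemma A_0 [simp]: "A 0 \<omega> = 0"
proof -
  have "AE r in lborel. indicat_real {0..0} r *\<^sub>R k r \<omega> = 0"
    by (rule AE_mp[OF AE_lborel_singleton[of 0] AE_I2]) (auto simp: indicator_def )
  then show ?thesis unfolding A_def set_lebesgue_integral_def by (rule integral_eq_zero_AE)
qed

lemma A_nonneg: "\<omega> \<in> space P \<Longrightarrow> 0 \<le> t \<Longrightarrow> 0 \<le> A t \<omega>"
  using A_increment(2)[of \<omega> 0 t] by simp

lemma C_nonneg: "0 \<le> C" using g_bound[of 0 undefined] by linarith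
lemma S_nonneg: "0 \<le> S" using W_bounds[of 0 undefined] by linarith
lemma \<Lambda>_nonneg: "0 \<le> \<Lambda>" using \<rho>_bounds[of 0] by linarith

text \<open>As \<open>g\<close> carries no measurability, it is read off from the martingale, which
  is integrable and differs from \<open>- I t\<close> by measurable functions.\<close>

lemma I_measurable: "0 \<le> t \<Longrightarrow> I t \<in> borel_measurable P"
proof -
  assume t: "0 \<le> t"
  let ?M = "\<lambda>\<omega>. W (fst (\<omega> t)) (snd (\<omega> t)) - W (fst (\<omega> 0)) (snd (\<omega> 0)) - I t \<omega>"
  have "integrable P ?M" using martingale t unfolding is_martingale_def I_def by simp
  then have [measurable]: "?M \<in> borel_measurable P" by simp
  have [measurable]: "w t \<in> borel_measurable P" "w 0 \<in> borel_measurable P" using t by (auto intro: w_measurable)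
  have "I t = (\<lambda>\<omega>. w t \<omega> - w 0 \<omega> - ?M \<omega>)" by (simp add: w_def fun_eq_iff)
  also have "\<dots> \<in> borel_measurable P" by measurable
  finally show ?thesis .
qed

text \<open>A single null set, the one where integrability along the path fails, serves all pairs of
  times.\<close>

lemma I_increment_bound: "AE \<omega> in P. \<forall>s t. 0 \<le> s \<longrightarrow> s \<le> t \<longrightarrow> \<bar>I t \<omega> - I s \<omega>\<bar> \<le> C * (t - s)"
  using g_integrable
proof eventually_elim
  case (elim \<omega>)
  show ?case
  proof (intro allI impI)
    fix s t :: real assume st: "0 \<le> s" "s \<le> t"
    let ?g = "\<lambda>r. g (fst (\<omega> r)) (snd (\<omega> r))"
    have eq: "I t \<omega> - I s \<omega> = (LINT r:{s<..t}|lborel. ?g r)"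
      unfolding I_def using elim st by (intro set_integral_increment) auto
    have int: "set_integrable lborel {s<..t} ?g"
      by (rule set_integrable_subset[of _ "{0..t}"]) (use elim st in auto)
    have intc: "set_integrable lborel {s<..t} (\<lambda>r. c)" for c :: real
      by (rule set_integrable_const_Ioc[OF st(2)])
    have b: "- C \<le> ?g r" "?g r \<le> C" for r using g_bound[of "fst (\<omega> r)" "snd (\<omega> r)"] by auto
    show "\<bar>I t \<omega> - I s \<omega>\<bar> \<le> C * (t - s)"
      using set_integral_mono[OF intc[of "- C"] int b(1)] set_integral_mono[OF int intc[of C] b(2)]
      unfolding eq by (simp add: set_integral_const_Ioc[OF st(2)])
  qed
qed

section \<open>Short-time estimates for the killed process\<close>

lemma bounded_integrable:
  fixes f :: "(real \<Rightarrow> (real^'n) \<times> 'm) \<Rightarrow> real"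
  shows "f \<in> borel_measurable P \<Longrightarrow> (AE \<omega> in P. \<bar>f \<omega>\<bar> \<le> B) \<Longrightarrow> integrable P f"
  by (rule integrable_const_bound[of f B]) auto

text \<open>Martingale increments integrate to 0 against weights known at time \<open>s\<close>, so
  increments of \<open>w\<close> may be exchanged for those of \<open>I\<close>; the last bound then
  follows from the Lipschitz estimate for \<open>I\<close>.\<close>

lemma weighted_increment:
  assumes st: "0 \<le> s" "s \<le> t"
    and Y: "Y \<in> borel_measurable (path_filtration s)" and B: "\<And>\<omega>. \<omega> \<in> space P \<Longrightarrow> \<bar>Y \<omega>\<bar> \<le> B"
  shows "integrable P (\<lambda>\<omega>. Y \<omega> * (I t \<omega> - I s \<omega>))" (is ?i1)
    and "(\<integral>\<omega>. Y \<omega> * (w t \<omega> - w s \<omega>) \<partial>P) = (\<integral>\<omega>. Y \<omega> * (I t \<omega> - I s \<omega>) \<partial>P)" (is ?e)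
    and "\<bar>\<integral>\<omega>. Y \<omega> * (w t \<omega> - w s \<omega>) \<partial>P\<bar> \<le> B * (C * (t - s))" (is ?b)
proof -
  let ?M = "\<lambda>t \<omega>. w t \<omega> - w 0 \<omega> - I t \<omega>"
  have M: "integrable P (?M s)" "integrable P (?M t)" "AE \<omega> in P. real_cond_exp P (path_filtration s) (?M t) \<omega> = ?M s \<omega>"
    using martingale st unfolding is_martingale_def I_def w_def by auto
  have YP: "Y \<in> borel_measurable P" by (rule measurable_from_subalg[OF subalg_P Y])
  have [measurable]: "I t \<in> borel_measurable P" "I s \<in> borel_measurable P" "Y \<in> borel_measurable P"
    "w t \<in> borel_measurable P" "w s \<in> borel_measurable P" "w 0 \<in> borel_measurable P"
    using st YP by (auto intro: I_measurable w_measurable)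
  have B0: "0 \<le> B" using B not_empty by fastforce
  have bI: "AE \<omega> in P. \<bar>Y \<omega> * (I t \<omega> - I s \<omega>)\<bar> \<le> B * (C * (t - s))"
    using I_increment_bound AE_space
    by eventually_elim (use st B B0 in \<open>auto simp: abs_mult intro!: mult_mono\<close>)
  show i1: ?i1 by (rule bounded_integrable[OF _ bI]) measurable
  have i2: "integrable P (\<lambda>\<omega>. Y \<omega> * (w t \<omega> - w s \<omega>))"
  proof (rule bounded_integrable[of _ "B * S"])
    have "\<bar>w t \<omega> - w s \<omega>\<bar> \<le> S" for \<omega> using w_bounds[of t \<omega>] w_bounds[of s \<omega>] by linarith
    then show "AE \<omega> in P. \<bar>Y \<omega> * (w t \<omega> - w s \<omega>)\<bar> \<le> B * S"
      using B B0 by (intro AE_I2) (auto simp: abs_mult intro!: mult_mono)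
  qed measurable
  have i3: "integrable P (\<lambda>\<omega>. Y \<omega> * ?M s \<omega>)"
  proof (rule Bochner_Integration.integrable_bound[OF integrable_mult_right[OF integrable_abs[OF M(1)], of B]])
    show "AE \<omega> in P. norm (Y \<omega> * ?M s \<omega>) \<le> norm (B * \<bar>?M s \<omega>\<bar>)"
      by (rule AE_I2) (auto simp: abs_mult intro!: mult_right_mono order_trans[OF B])
  qed measurable
  have "(\<integral>\<omega>. Y \<omega> * ?M t \<omega> \<partial>P) = (\<integral>\<omega>. Y \<omega> * ?M s \<omega> \<partial>P)"
    by (rule integral_mult_cond_exp_eq[OF subalg_P M(2,1) Y B M(3)])
  also have "(\<lambda>\<omega>. Y \<omega> * ?M t \<omega>) = (\<lambda>\<omega>. Y \<omega> * ?M s \<omega> + (Y \<omega> * (w t \<omega> - w s \<omega>) - Y \<omega> * (I t \<omega> - I s \<omega>)))"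
    by (simp add: algebra_simps fun_eq_iff)
  finally show e: ?e using i1 i2 i3 by simp
  have "\<bar>\<integral>\<omega>. Y \<omega> * (I t \<omega> - I s \<omega>) \<partial>P\<bar> \<le> (\<integral>\<omega>. \<bar>Y \<omega> * (I t \<omega> - I s \<omega>)\<bar> \<partial>P)"
    by (rule integral_abs_bound)
  also have "\<dots> \<le> (\<integral>\<omega>. B * (C * (t - s)) \<partial>P)"
    by (rule integral_mono_AE[OF integrable_abs[OF i1] _ bI]) simp
  finally show ?b unfolding e by (simp add: prob_space)
qed

text \<open>Controls the error of replacing \<open>w r\<close> by \<open>w t\<close> in the killing
  term. For each \<open>r\<close> the weight \<open>Y \<omega> * k r \<omega>\<close> is known at
  time \<open>r\<close>, so the weighted mean change of \<open>w\<close> from \<open>r\<close> to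
  \<open>t\<close> is of order \<open>t - r\<close>; integrating over \<open>r\<close> yields the
  square.\<close>

lemma killing_increment:
  assumes st: "0 \<le> s" "s \<le> t"
    and Y: "Y \<in> borel_measurable (path_filtration s)" and Y01: "\<And>\<omega>. \<omega> \<in> space P \<Longrightarrow> 0 \<le> Y \<omega> \<and> Y \<omega> \<le> 1"
  shows "integrable P (\<lambda>\<omega>. Y \<omega> * (LINT r:{s<..t}|lborel. k r \<omega> * (w t \<omega> - w r \<omega>)))"
    and "- (\<Lambda> * C * (t - s)\<^sup>2) \<le> (\<integral>\<omega>. Y \<omega> * (LINT r:{s<..t}|lborel. k r \<omega> * (w t \<omega> - w r \<omega>)) \<partial>P)"
proof -
  have t0: "0 \<le> t" using st by simp
  \<comment> \<open>Clamped times make the integrand jointly measurable; the indicator restricts it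
    to times at which clamping is inactive.\<close>
  define h where "h \<omega> r = indicator {s<..t} r *
      (Y \<omega> * (k (max 0 (min t r)) \<omega> * (w t \<omega> - w (max 0 (min t r)) \<omega>)))" for \<omega> r
  note [measurable] = progressive_P(1,2)[OF t0] w_measurable[OF t0] measurable_from_subalg[OF subalg_P Y]
  interpret pair_sigma_finite P lborel ..
  have meas: "case_prod h \<in> borel_measurable (P \<Otimes>\<^sub>M lborel)"
    unfolding h_def split_beta' by measurable
  have k_w: "\<bar>k r \<omega> * (w t \<omega> - w r \<omega>)\<bar> \<le> \<Lambda> * S" for r \<omega>
    using k_bounds[of r \<omega>] w_bounds[of t \<omega>] w_bounds[of r \<omega>] \<Lambda>_nonneg
    unfolding abs_mult by (intro mult_mono) auto
  have int: "integrable (P \<Otimes>\<^sub>M lborel) (case_prod h)"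
  proof (rule integrableI_bounded_set[where A = "space P \<times> {s<..t}" and B = "\<Lambda> * S"])
    show "emeasure (P \<Otimes>\<^sub>M lborel) (space P \<times> {s<..t}) < \<infinity>"
      using st by (simp add: lborel.emeasure_pair_measure_Times emeasure_space_1)
    show "AE p in P \<Otimes>\<^sub>M lborel. p \<in> space P \<times> {s<..t} \<longrightarrow> norm (case_prod h p) \<le> \<Lambda> * S"
    proof (intro AE_I2 impI)
      fix p assume p: "p \<in> space P \<times> {s<..t}"
      have "\<bar>Y (fst p)\<bar> * \<bar>k (max 0 (min t (snd p))) (fst p) * (w t (fst p) - w (max 0 (min t (snd p))) (fst p))\<bar> \<le> 1 * (\<Lambda> * S)"
        using Y01[of "fst p"] p k_w by (intro mult_mono) auto
      then show "norm (case_prod h p) \<le> \<Lambda> * S"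
        using p by (cases p) (simp add: h_def abs_mult)
    qed
    show "AE p in P \<Otimes>\<^sub>M lborel. p \<notin> space P \<times> {s<..t} \<longrightarrow> case_prod h p = 0"
      by (rule AE_I2) (auto simp: h_def space_pair_measure indicator_def)
  qed (use meas in auto)
  have inner: "(\<integral>r. h \<omega> r \<partial>lborel) = Y \<omega> * (LINT r:{s<..t}|lborel. k r \<omega> * (w t \<omega> - w r \<omega>))" for \<omega>
  proof -
    have "(\<integral>r. h \<omega> r \<partial>lborel) = (\<integral>r. Y \<omega> * (indicator {s<..t} r *\<^sub>R (k r \<omega> * (w t \<omega> - w r \<omega>))) \<partial>lborel)"
      using st by (intro Bochner_Integration.integral_cong) (auto simp: h_def indicator_def)
    then show ?thesis by (simp add: set_lebesgue_integral_def)
  qed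
  show "integrable P (\<lambda>\<omega>. Y \<omega> * (LINT r:{s<..t}|lborel. k r \<omega> * (w t \<omega> - w r \<omega>)))"
    using integrable_fst[OF int] by (simp add: inner)
  have outer: "indicator {s<..t} r * (- (\<Lambda> * (C * (t - s)))) \<le> (\<integral>\<omega>. h \<omega> r \<partial>P)" for r
  proof (cases "r \<in> {s<..t}")
    case True
    \<comment> \<open>The weight involves the state at time \<open>r\<close>, so
      \<open>weighted_increment\<close> is applied from \<open>r\<close>, not from
      \<open>s\<close>.\<close>
    have "k r \<in> borel_measurable (path_filtration r)"
      using True st by (intro k_measurable_F) auto
    moreover have "subalgebra (path_filtration r) (path_filtration s)"
      using sets_path_filtration_mono[of s r] True by (auto simp: subalgebra_def)
    ultimately have "(\<lambda>\<omega>. Y \<omega> * k r \<omega>) \<in> borel_measurable (path_filtration r)"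
      using measurable_from_subalg[OF _ Y] by (intro borel_measurable_times)
    moreover have "\<bar>Y \<omega> * k r \<omega>\<bar> \<le> \<Lambda>" if "\<omega> \<in> space P" for \<omega>
    proof -
      have "\<bar>Y \<omega> * k r \<omega>\<bar> \<le> 1 * \<Lambda>"
        unfolding abs_mult using Y01[OF that] k_bounds[of r \<omega>] by (intro mult_mono) auto
      then show ?thesis by simp
    qed
    ultimately have "\<bar>\<integral>\<omega>. (Y \<omega> * k r \<omega>) * (w t \<omega> - w r \<omega>) \<partial>P\<bar> \<le> \<Lambda> * (C * (t - r))"
      using True st by (intro weighted_increment(3)) auto
    moreover have "\<Lambda> * (C * (t - r)) \<le> \<Lambda> * (C * (t - s))"
      using True \<Lambda>_nonneg C_nonneg by (intro mult_left_mono) auto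
    moreover have "max 0 (min t r) = r" using True st by auto
    ultimately show ?thesis using True by (simp add: h_def mult.assoc)
  qed (simp add: h_def)
  have "- (\<Lambda> * C * (t - s)\<^sup>2) = (\<integral>r. indicator {s<..t} r * (- (\<Lambda> * (C * (t - s)))) \<partial>lborel)"
    using st by (simp add: power2_eq_square)
  also have "\<dots> \<le> (\<integral>r. (\<integral>\<omega>. h \<omega> r \<partial>P) \<partial>lborel)"
  proof (rule integral_mono[OF _ integrable_snd[OF int] outer])
    show "integrable lborel (\<lambda>r. indicat_real {s<..t} r * (- (\<Lambda> * (C * (t - s)))))"
      using set_integrable_const_Ioc[OF st(2), of "- (\<Lambda> * (C * (t - s)))"]
      by (simp only: set_integrable_def real_scaleR_def)
  qed
  also have "\<dots> = (\<integral>\<omega>. Y \<omega> * (LINT r:{s<..t}|lborel. k r \<omega> * (w t \<omega> - w r \<omega>)) \<partial>P)"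
    using Fubini_integral[OF int] by (simp add: inner)
  finally show "- (\<Lambda> * C * (t - s)\<^sup>2) \<le> (\<integral>\<omega>. Y \<omega> * (LINT r:{s<..t}|lborel. k r \<omega> * (w t \<omega> - w r \<omega>)) \<partial>P)" .
qed

text \<open>Integrates the supersolution inequality along a path. That inequality pairs the rate at
  time \<open>r\<close> with \<open>w r\<close>, whereas expanding the survival weight produces
  \<open>w t\<close>; the difference is the error term treated by
  \<open>killing_increment\<close>.\<close>

lemma drift_increment_le:
  assumes st: "0 \<le> s" "s \<le> t"
  shows "AE \<omega> in P. I t \<omega> - I s \<omega> - (A t \<omega> - A s \<omega>) * w t \<omega> \<le>
    - (LINT r:{s<..t}|lborel. k r \<omega> * (w t \<omega> - w r \<omega>)) - indicator avoid \<omega> * (A t \<omega> - A s \<omega>)"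
  using g_integrable AE_space
proof eventually_elim
  case (elim \<omega>)
  let ?g = "\<lambda>r. g (fst (\<omega> r)) (snd (\<omega> r))" and ?d = "\<lambda>r. k r \<omega> * indicator (- D) (fst (\<omega> r))"
  have sub: "set_integrable lborel {s<..t} f" if "set_integrable lborel {0..t} f" for f :: "real \<Rightarrow> real"
    by (rule set_integrable_subset[OF that]) (use st in auto)
  have int: "set_integrable lborel {s<..t} ?g" using elim st by (intro sub) auto
  note pint = path_set_integrable[OF elim(2) order_refl, of t, THEN sub]
  have "I t \<omega> - I s \<omega> = (LINT r:{s<..t}|lborel. ?g r)"
    unfolding I_def using elim st by (intro set_integral_increment) auto
  also have "\<dots> \<le> (LINT r:{s<..t}|lborel. k r \<omega> * w r \<omega> - ?d r)"
  proof (rule set_integral_mono[OF int set_integral_diff(1)[OF pint(2,3)]])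
    show "?g r \<le> k r \<omega> * w r \<omega> - ?d r" for r
      using supersolution[of "fst (\<omega> r)" "snd (\<omega> r)"] by (simp add: k_def w_def)
  qed
  also have "\<dots> = (LINT r:{s<..t}|lborel. k r \<omega> * w r \<omega>) - (LINT r:{s<..t}|lborel. ?d r)"
    using pint by simp
  finally have 1: "I t \<omega> - I s \<omega> \<le> (LINT r:{s<..t}|lborel. k r \<omega> * w r \<omega>) - (LINT r:{s<..t}|lborel. ?d r)" .
  have "(LINT r:{s<..t}|lborel. k r \<omega> * (w t \<omega> - w r \<omega>)) = (LINT r:{s<..t}|lborel. w t \<omega> * k r \<omega> - k r \<omega> * w r \<omega>)"
    by (simp add: algebra_simps)
  also have "\<dots> = w t \<omega> * (LINT r:{s<..t}|lborel. k r \<omega>) - (LINT r:{s<..t}|lborel. k r \<omega> * w r \<omega>)"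
    using pint by (subst set_integral_diff(2)) auto
  finally have 2: "(LINT r:{s<..t}|lborel. k r \<omega> * (w t \<omega> - w r \<omega>)) =
    w t \<omega> * (A t \<omega> - A s \<omega>) - (LINT r:{s<..t}|lborel. k r \<omega> * w r \<omega>)"
    using A_increment(1)[OF elim(2) st] by simp
  \<comment> \<open>A path in \<open>avoid\<close> is outside \<open>D\<close> at all times, so
    restricting the rate to the complement of \<open>D\<close> changes nothing; for other paths
    nonnegativity suffices.\<close>
  have 3: "indicator avoid \<omega> * (A t \<omega> - A s \<omega>) \<le> (LINT r:{s<..t}|lborel. ?d r)"
  proof (cases "\<omega> \<in> avoid")
    case True
    have "(LINT r:{s<..t}|lborel. k r \<omega>) \<le> (LINT r:{s<..t}|lborel. ?d r)"
      by (rule set_integral_mono[OF pint(1,3)]) (use True st in \<open>auto simp: avoid_def\<close>)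
    then show ?thesis using True A_increment(1)[OF elim(2) st] by simp
  next
    case False
    have "0 \<le> (LINT r:{s<..t}|lborel. ?d r)"
      unfolding set_lebesgue_integral_def
      by (intro integral_nonneg_AE AE_I2 scaleR_nonneg_nonneg mult_nonneg_nonneg k_bounds) auto
    then show ?thesis using False by simp
  qed
  show ?case using 1 2 3 by (simp add: algebra_simps)
qed

text \<open>Split off \<open>exp (- A s \<omega>)\<close> and expand the remaining exponential
  factor; the first-order terms are compared by \<open>drift_increment_le\<close>. The remainder of
  the exponential contributes \<open>\<Lambda>\<^sup>2 * S / 2\<close>, and the error from
  \<open>killing_increment\<close> contributes \<open>\<Lambda> * C\<close>.\<close>

lemma killed_step:
  assumes st: "0 \<le> s" "s \<le> t"
  shows "(\<integral>\<omega>. exp (- A t \<omega>) * w t \<omega> \<partial>P) - (\<integral>\<omega>. indicator avoid \<omega> * exp (- A t \<omega>) \<partial>P)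
    \<le> (\<integral>\<omega>. exp (- A s \<omega>) * w s \<omega> \<partial>P) - (\<integral>\<omega>. indicator avoid \<omega> * exp (- A s \<omega>) \<partial>P)
      + (\<Lambda>\<^sup>2 * S / 2 + \<Lambda> * C) * (t - s)\<^sup>2"
proof -
  have t0: "0 \<le> t" using st by simp
  let ?Y = "\<lambda>\<omega>. exp (- A s \<omega>)" and ?a = "\<lambda>\<omega>. A t \<omega> - A s \<omega>"
  let ?E = "\<lambda>\<omega>. LINT r:{s<..t}|lborel. k r \<omega> * (w t \<omega> - w r \<omega>)"
  let ?q = "(\<Lambda> * (t - s))\<^sup>2 / 2 * S"
  have Y: "?Y \<in> borel_measurable (path_filtration s)"
    using A_measurable_F[OF st(1)] by measurable
  have Y01: "0 \<le> ?Y \<omega> \<and> ?Y \<omega> \<le> 1" if "\<omega> \<in> space P" for \<omega> using A_nonneg[OF that st(1)] by simp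
  note [measurable] = A_measurable[OF st(1)] A_measurable[OF t0] w_measurable[OF st(1)] w_measurable[OF t0]
    I_measurable[OF st(1)] I_measurable[OF t0]
  have Yb: "\<bar>?Y \<omega> * f\<bar> \<le> B" if "\<omega> \<in> space P" "\<bar>f\<bar> \<le> B" for \<omega> f B
  proof -
    have "\<bar>?Y \<omega>\<bar> * \<bar>f\<bar> \<le> 1 * B" using Y01[OF that(1)] that(2) by (intro mult_mono) auto
    then show ?thesis by (simp add: abs_mult)
  qed
  have bA: "\<bar>?a \<omega>\<bar> \<le> \<Lambda> * (t - s)" if "\<omega> \<in> space P" for \<omega>
    using A_increment(2,3)[OF that st] by simp
  have bw: "\<bar>w r \<omega>\<bar> \<le> S" for r \<omega> using w_bounds[of r \<omega>] by simp
  have iw: "integrable P (\<lambda>\<omega>. ?Y \<omega> * w r \<omega>)" if "r \<in> {s, t}" for r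
    by (rule bounded_integrable[where B = S])
      (use that in \<open>auto intro!: AE_I2 Yb bw\<close>)
  have ia: "integrable P (\<lambda>\<omega>. ?Y \<omega> * (?a \<omega> * w t \<omega>))"
  proof (rule bounded_integrable[where B = "\<Lambda> * (t - s) * S"])
    show "AE \<omega> in P. \<bar>?Y \<omega> * (?a \<omega> * w t \<omega>)\<bar> \<le> \<Lambda> * (t - s) * S"
    proof (intro AE_I2 Yb)
      fix \<omega> assume "\<omega> \<in> space P"
      then show "\<bar>?a \<omega> * w t \<omega>\<bar> \<le> \<Lambda> * (t - s) * S"
        unfolding abs_mult using bA bw st \<Lambda>_nonneg by (intro mult_mono) auto
    qed
  qed measurable
  have iv: "integrable P (\<lambda>\<omega>. ?Y \<omega> * (indicator avoid \<omega> * ?a \<omega>))"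
  proof (rule bounded_integrable[where B = "\<Lambda> * (t - s)"])
    show "AE \<omega> in P. \<bar>?Y \<omega> * (indicator avoid \<omega> * ?a \<omega>)\<bar> \<le> \<Lambda> * (t - s)"
    proof (intro AE_I2 Yb)
      fix \<omega> assume "\<omega> \<in> space P"
      then show "\<bar>indicator avoid \<omega> * ?a \<omega>\<bar> \<le> \<Lambda> * (t - s)"
        using bA[of \<omega>] st \<Lambda>_nonneg by (auto simp: indicator_def)
    qed
  qed measurable
  have iZ: "integrable P (\<lambda>\<omega>. indicator avoid \<omega> * exp (- A r \<omega>))" if "r \<in> {s, t}" for r
  proof (rule bounded_integrable[where B = 1])
    have "0 \<le> r" using that st by auto
    then show "AE \<omega> in P. \<bar>indicator avoid \<omega> * exp (- A r \<omega>)\<bar> \<le> 1"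
      using A_nonneg by (intro AE_I2) (auto simp: indicator_def)
  qed (use that in auto)
  have iZw: "integrable P (\<lambda>\<omega>. exp (- A t \<omega>) * w t \<omega>)"
  proof (rule bounded_integrable[where B = "1 * S"])
    show "AE \<omega> in P. \<bar>exp (- A t \<omega>) * w t \<omega>\<bar> \<le> 1 * S"
      unfolding abs_mult using A_nonneg[OF _ t0] bw by (intro AE_I2 mult_mono) auto
  qed measurable
  have i1: "integrable P (\<lambda>\<omega>. ?Y \<omega> * (I t \<omega> - I s \<omega>))"
    and e1: "(\<integral>\<omega>. ?Y \<omega> * (w t \<omega> - w s \<omega>) \<partial>P) = (\<integral>\<omega>. ?Y \<omega> * (I t \<omega> - I s \<omega>) \<partial>P)"
    using weighted_increment(1,2)[OF st Y, of 1] Y01 by auto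
  note E = killing_increment[OF st Y Y01]

  \<comment> \<open>The survival weight multiplies the nonnegative \<open>w\<close> and has to be
    bounded above, hence the expansion to second order.\<close>
  have "(\<integral>\<omega>. exp (- A t \<omega>) * w t \<omega> \<partial>P) \<le> (\<integral>\<omega>. ?Y \<omega> * w t \<omega> - ?Y \<omega> * (?a \<omega> * w t \<omega>) + ?q \<partial>P)"
  proof (rule integral_mono[OF iZw])
    fix \<omega> assume \<omega>: "\<omega> \<in> space P"
    have "exp (- A t \<omega>) = ?Y \<omega> * exp (- ?a \<omega>)" by (simp flip: exp_add)
    also have "\<dots> * w t \<omega> \<le> (?Y \<omega> * (1 - ?a \<omega> + (?a \<omega>)\<^sup>2 / 2)) * w t \<omega>"
      using exp_minus_le_quadratic[OF A_increment(2)[OF \<omega> st]] w_bounds by (intro mult_right_mono mult_left_mono) auto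
    also have "\<dots> = ?Y \<omega> * w t \<omega> - ?Y \<omega> * (?a \<omega> * w t \<omega>) + ?Y \<omega> * ((?a \<omega>)\<^sup>2 / 2 * w t \<omega>)"
      by (simp add: algebra_simps)
    also have "?Y \<omega> * ((?a \<omega>)\<^sup>2 / 2 * w t \<omega>) \<le> 1 * ?q"
      using Y01[OF \<omega>] A_increment(2,3)[OF \<omega> st] w_bounds S_nonneg
      by (intro mult_mono divide_right_mono power_mono) auto
    finally show "exp (- A t \<omega>) * w t \<omega> \<le> ?Y \<omega> * w t \<omega> - ?Y \<omega> * (?a \<omega> * w t \<omega>) + ?q" by simp
  qed (use iw ia in auto)
  also have "\<dots> = (\<integral>\<omega>. ?Y \<omega> * w s \<omega> \<partial>P) + (\<integral>\<omega>. ?Y \<omega> * (w t \<omega> - w s \<omega>) \<partial>P) - (\<integral>\<omega>. ?Y \<omega> * (?a \<omega> * w t \<omega>) \<partial>P) + ?q"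
    using iw ia by (simp add: right_diff_distrib prob_space)
  also have "\<dots> = (\<integral>\<omega>. ?Y \<omega> * w s \<omega> \<partial>P) + (\<integral>\<omega>. ?Y \<omega> * (I t \<omega> - I s \<omega>) - ?Y \<omega> * (?a \<omega> * w t \<omega>) \<partial>P) + ?q"
    unfolding e1 using i1 ia by simp
  also have "(\<integral>\<omega>. ?Y \<omega> * (I t \<omega> - I s \<omega>) - ?Y \<omega> * (?a \<omega> * w t \<omega>) \<partial>P) \<le>
    (\<integral>\<omega>. - (?Y \<omega> * ?E \<omega>) - ?Y \<omega> * (indicator avoid \<omega> * ?a \<omega>) \<partial>P)"
  proof (rule integral_mono_AE)
    show "AE \<omega> in P. ?Y \<omega> * (I t \<omega> - I s \<omega>) - ?Y \<omega> * (?a \<omega> * w t \<omega>)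
      \<le> - (?Y \<omega> * ?E \<omega>) - ?Y \<omega> * (indicator avoid \<omega> * ?a \<omega>)"
      using drift_increment_le[OF st]
    proof eventually_elim
      case (elim \<omega>)
      from mult_left_mono[OF this, of "?Y \<omega>"] show ?case by (simp add: algebra_simps)
    qed
  qed (use i1 ia iv E in auto)
  also have "(\<integral>\<omega>. - (?Y \<omega> * ?E \<omega>) - ?Y \<omega> * (indicator avoid \<omega> * ?a \<omega>) \<partial>P)
     = - (\<integral>\<omega>. ?Y \<omega> * ?E \<omega> \<partial>P) - (\<integral>\<omega>. ?Y \<omega> * (indicator avoid \<omega> * ?a \<omega>) \<partial>P)"
    using E iv by simp
  finally have "(\<integral>\<omega>. exp (- A t \<omega>) * w t \<omega> \<partial>P) \<le> (\<integral>\<omega>. ?Y \<omega> * w s \<omega> \<partial>P) + (- (\<integral>\<omega>. ?Y \<omega> * ?E \<omega> \<partial>P)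
     - (\<integral>\<omega>. ?Y \<omega> * (indicator avoid \<omega> * ?a \<omega>) \<partial>P)) + ?q" by simp
  \<comment> \<open>The avoidance term enters with a minus sign, so the linear lower bound for the
    exponential suffices.\<close>
  moreover have "(\<integral>\<omega>. indicator avoid \<omega> * ?Y \<omega> - indicator avoid \<omega> * exp (- A t \<omega>) \<partial>P) \<le> (\<integral>\<omega>. ?Y \<omega> * (indicator avoid \<omega> * ?a \<omega>) \<partial>P)"
  proof (rule integral_mono[OF _ iv])
    fix \<omega> assume \<omega>: "\<omega> \<in> space P"
    have "exp (- A t \<omega>) = ?Y \<omega> * exp (- ?a \<omega>)" by (simp flip: exp_add)
    also have "\<dots> \<ge> ?Y \<omega> * (1 - ?a \<omega>)"
      by (rule mult_left_mono[OF _ exp_ge_zero]) (use exp_ge_add_one_self[of "- ?a \<omega>"] in linarith)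
    finally show "indicator avoid \<omega> * ?Y \<omega> - indicator avoid \<omega> * exp (- A t \<omega>) \<le> ?Y \<omega> * (indicator avoid \<omega> * ?a \<omega>)"
      by (auto simp: indicator_def algebra_simps)
  qed (use iZ in auto)
  moreover have "(\<integral>\<omega>. indicator avoid \<omega> * ?Y \<omega> - indicator avoid \<omega> * exp (- A t \<omega>) \<partial>P) =
    (\<integral>\<omega>. indicator avoid \<omega> * ?Y \<omega> \<partial>P) - (\<integral>\<omega>. indicator avoid \<omega> * exp (- A t \<omega>) \<partial>P)"
    using iZ by simp
  moreover have "(\<Lambda>\<^sup>2 * S / 2 + \<Lambda> * C) * (t - s)\<^sup>2 = ?q + \<Lambda> * C * (t - s)\<^sup>2"
    unfolding power_mult_distrib by (simp add: distrib_right)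
  ultimately show ?thesis using E(2) by linarith
qed

text \<open>The function \<open>?\<Phi>\<close> starts at \<open>W x i - prob avoid\<close> and does
  not increase. Its \<open>w\<close> term is nonnegative and its avoidance term decays at rate
  \<open>\<eta>\<close>, so it is asymptotically bounded below by 0.\<close>

lemma prob_avoid_le:
  assumes init: "AE \<omega> in P. \<omega> 0 = (x, i)" and \<eta>: "0 < \<eta>" "\<And>x. \<eta> \<le> \<rho> x"
  shows "prob avoid \<le> W x i"
proof -
  let ?\<Phi> = "\<lambda>t. (\<integral>\<omega>. exp (- A t \<omega>) * w t \<omega> \<partial>P) - (\<integral>\<omega>. indicator avoid \<omega> * exp (- A t \<omega>) \<partial>P)"
  have "(\<integral>\<omega>. w 0 \<omega> \<partial>P) = (\<integral>\<omega>. W x i \<partial>P)"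
    using w_measurable[of 0] init by (intro integral_cong_AE) (auto simp: w_def[abs_def])
  then have \<Phi>0: "?\<Phi> 0 = W x i - prob avoid" by (simp add: prob_space)
  have "prob avoid \<le> W x i + exp (- (\<eta> * real n))" for n
  proof -
    have "- exp (- (\<eta> * real n)) \<le> - (\<integral>\<omega>. indicator avoid \<omega> * exp (- A (real n) \<omega>) \<partial>P)"
    proof -
      have "(\<integral>\<omega>. indicator avoid \<omega> * exp (- A (real n) \<omega>) \<partial>P) \<le> (\<integral>\<omega>. exp (- (\<eta> * real n)) \<partial>P)"
      proof (rule integral_mono)
        fix \<omega> assume \<omega>: "\<omega> \<in> space P"
        have "\<eta> * real n \<le> A (real n) \<omega>" using A_increment(4)[OF \<omega>, of 0 "real n" \<eta>] \<eta>(2) by simp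
        then show "indicator avoid \<omega> * exp (- A (real n) \<omega>) \<le> exp (- (\<eta> * real n))"
          by (auto simp: indicator_def)
      next
        show "integrable P (\<lambda>\<omega>. indicator avoid \<omega> * exp (- A (real n) \<omega>))"
        proof (rule bounded_integrable[where B = 1])
          show "AE \<omega> in P. \<bar>indicator avoid \<omega> * exp (- A (real n) \<omega>)\<bar> \<le> 1"
            using A_nonneg by (intro AE_I2) (auto simp: indicator_def)
        qed (use A_measurable in measurable)
      qed simp
      then show ?thesis by (simp add: prob_space)
    qed
    also have "\<dots> \<le> ?\<Phi> (real n)"
      using w_bounds by (auto intro!: integral_nonneg_AE AE_I2)
    also have "\<dots> \<le> ?\<Phi> 0"
      by (rule antimono_if_quadratic_increments[OF killed_step]) auto
    finally show ?thesis using \<Phi>0 by linarith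
  qed
  moreover have "(\<lambda>n. W x i + exp (- (\<eta> * real n))) \<longlonglongrightarrow> W x i + 0"
  proof (intro tendsto_intros filterlim_compose[OF exp_at_bot])
    show "filterlim (\<lambda>n. - (\<eta> * real n)) at_bot sequentially"
      using \<eta>(1) by (intro filterlim_uminus_at_bot_at_top[THEN filterlim_compose] filterlim_tendsto_pos_mult_at_top[OF tendsto_const] filterlim_real_sequentially)
  qed
  ultimately show ?thesis by (intro LIMSEQ_le_const) (auto intro!: exI[of _ 0])
qed

end

section \<open>Construction of a supersolution\<close>

context regime_switching_jump_diffusion
begin

text \<open>Near the ball, \<open>H\<close> is one minus an exponential in a single coordinate, with a rate so large
  that ellipticity dominates the drift and the big jumps; convexity gives the small jumps the right
  sign.\<close>

lemma local_strict_supersolution: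
  fixes n :: real
  assumes n: "0 < n"
  shows "\<exists>(H :: real^'n \<Rightarrow> real) c R. C2 H \<and> (\<forall>x. 0 \<le> H x \<and> H x \<le> 1) \<and>
    (\<forall>x. R \<le> norm x \<longrightarrow> H x = 1) \<and> 0 < c \<and>
    (\<forall>x i. norm x < n \<longrightarrow> generator b \<sigma> \<pi> Q (\<lambda>x i. H x) x i \<le> - c)"
proof -
  \<comment> \<open>An arbitrary coordinate direction; ellipticity bounds each diagonal entry of the
    diffusion matrix from below.\<close>
  obtain k0 :: 'n where True by simp
  obtain \<kappa> where \<kappa>: "\<kappa> > 0" "\<And>\<xi> x i. x \<in> ball 0 n \<Longrightarrow> \<kappa> * (norm \<xi>)\<^sup>2 \<le> \<xi> \<bullet> (diffusion_matrix \<sigma> x i *v \<xi>)"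
  proof -
    have "is_domain (ball (0::real^'n) n)" using n by (simp add: is_domain_def)
    from local_ellipticity[OF this bounded_ball] show ?thesis using that by metis
  qed
  have a_ge: "\<kappa> \<le> diffusion_matrix \<sigma> x i $ k0 $ k0" if "x \<in> ball 0 n" for x i
    using \<kappa>(2)[OF that, of "axis k0 1" i]
    by (simp add: inner_axis' matrix_vector_mul_component norm_axis_1 inner_axis)
  obtain c0 where c0: "c0 > 0" "\<And>x i. (\<Sum>k\<in>UNIV. \<Sum>l\<in>UNIV. \<bar>\<sigma> x i $ k $ l\<bar>) + (\<Sum>k\<in>UNIV. \<bar>b x i $ k\<bar>) \<le> c0 * (1 + norm x)"
    using linear_growth by metis
  define C where "C = c0 * (1 + n)"
  have C: "\<bar>b x i $ k0\<bar> \<le> C" if "norm x < n" for x i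
  proof -
    have "\<bar>b x i $ k0\<bar> \<le> (\<Sum>k\<in>UNIV. \<bar>b x i $ k\<bar>)" by (rule member_le_sum) auto
    also have "\<dots> \<le> c0 * (1 + norm x)"
    proof -
      have "0 \<le> (\<Sum>k\<in>UNIV. \<Sum>l\<in>UNIV. \<bar>\<sigma> x i $ k $ l\<bar>)" by (intro sum_nonneg) auto
      then show ?thesis using c0(2)[of x i] by linarith
    qed
    also have "\<dots> \<le> C" unfolding C_def using that c0(1) by (intro mult_left_mono) auto
    finally show ?thesis .
  qed
  have C0: "0 \<le> C" using c0(1) n by (simp add: C_def)
  obtain K where K: "0 \<le> K" "\<And>i x. emeasure (\<pi> i x) (- ball 0 1) \<le> ennreal K"
    using big_jumps_bound by metis
  \<comment> \<open>Makes \<open>\<kappa> * \<mu> / 2\<close> at least \<open>C + K + 1\<close>,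
    which pays for the drift, the big jumps and a surplus of 1. The leading summand ensures
    \<open>1 \<le> \<mu>\<close>.\<close>
  define \<mu> where "\<mu> = 1 + 2 * (C + K + 1) / \<kappa>"
  have \<mu>: "1 \<le> \<mu>" using \<kappa>(1) C0 K(1) by (simp add: \<mu>_def)
  have \<mu>_large: "1 \<le> (1/2) * \<kappa> * \<mu>\<^sup>2 - C * \<mu> - K"
  proof -
    have "\<mu> * (C + K + 1) \<le> \<mu> * ((1/2) * \<kappa> * \<mu>)"
      using \<kappa>(1) \<mu> by (intro mult_left_mono) (auto simp: \<mu>_def field_simps)
    moreover have "K + 1 \<le> \<mu> * (K + 1)" using \<mu> K(1) by (simp add: mult_le_cancel_right1)
    ultimately show ?thesis by (simp add: power2_eq_square algebra_simps)
  qed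

  \<comment> \<open>The shift by \<open>n + 2\<close> keeps \<open>e\<close> at most 1 on the ball
    of that radius, because a coordinate never exceeds the norm.\<close>
  define e where "e y = exp (\<mu> * (y $ k0 - (n + 2)))" for y :: "real^'n"
  define s where "s y = ((n + 1)\<^sup>2 + 1) - (norm y)\<^sup>2" for y :: "real^'n"
  \<comment> \<open>A cutoff made of nested positive parts: \<open>s y\<close> is at least 1 for
    \<open>norm y \<le> n + 1\<close>, which gives the value 1, and at most 0 for
    \<open>n + 2 \<le> norm y\<close>, which gives 0. The radius \<open>n + 1\<close> covers every
    point reached from the ball of radius \<open>n\<close> by a jump shorter than 1.\<close>
  define \<theta> where "\<theta> y = 1 - max 0 (1 - max 0 (s y) ^ 3) ^ 3" for y
  define H where "H y = 1 - e y * \<theta> y" for y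
  define H0 where "H0 y = 1 - e y" for y

  have \<theta>01: "0 \<le> \<theta> y" "\<theta> y \<le> 1" for y
    unfolding \<theta>_def by (auto intro!: power_le_one)
  have \<theta>1: "\<theta> y = 1" if "norm y \<le> n + 1" for y
  proof -
    have "(norm y)\<^sup>2 \<le> (n + 1)\<^sup>2" using that by (intro power_mono) auto
    then have "1 \<le> max 0 (s y) ^ 3" unfolding s_def by (intro one_le_power) auto
    then show ?thesis by (simp add: \<theta>_def max_def)
  qed
  have \<theta>0: "\<theta> y = 0" if "n + 2 \<le> norm y" for y
  proof -
    have "(n + 2)\<^sup>2 \<le> (norm y)\<^sup>2" using that n by (intro power_mono) auto
    then have "s y \<le> 0" using n by (simp add: s_def power2_eq_square algebra_simps)
    then show ?thesis by (simp add: \<theta>_def max_def)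
  qed
  have g1: "e y * \<theta> y \<le> 1" for y
  proof (cases "n + 2 \<le> norm y")
    case False
    have "y $ k0 \<le> norm y" using component_le_norm_cart[of y k0] by simp
    then have "e y \<le> 1" using False \<mu> by (simp add: e_def mult_le_0_iff)
    then have "e y * \<theta> y \<le> 1 * 1" using \<theta>01 by (intro mult_mono) auto
    then show ?thesis by simp
  qed (simp add: \<theta>0)
  have "C2 e" unfolding e_def
    by (rule C2_compose[OF C2_nth, of _ "\<lambda>v. \<mu> * exp (\<mu> * (v - (n + 2)))" "\<lambda>v. \<mu>\<^sup>2 * exp (\<mu> * (v - (n + 2)))"])
      (auto intro!: derivative_eq_intros continuous_intros simp: power2_eq_square)
  moreover have "C2 \<theta>" unfolding \<theta>_def s_def
    by (intro C2_const_minus C2_pos_part_cube C2_norm_sq)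
  ultimately have C2H: "C2 H" unfolding H_def
    by (intro C2_const_minus C2_mult)
  have H01: "0 \<le> H y" "H y \<le> 1" for y
    using g1[of y] \<theta>01[of y] by (auto simp: H_def e_def)
  have Hout: "H y = 1" if "n + 2 \<le> norm y" for y using \<theta>0[OF that] by (simp add: H_def)

  have d1: "((\<lambda>v. 1 - exp (\<mu> * (v - (n + 2)))) has_real_derivative - \<mu> * exp (\<mu> * (v - (n + 2)))) (at v)" for v
    by (auto intro!: derivative_eq_intros)
  have d2: "((\<lambda>v. - \<mu> * exp (\<mu> * (v - (n + 2)))) has_real_derivative - \<mu>\<^sup>2 * exp (\<mu> * (v - (n + 2)))) (at v)" for v
    by (auto intro!: derivative_eq_intros simp: power2_eq_square)
  have pH0: "partial k H0 y = (if k = k0 then - \<mu> * e y else 0)" for k y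
    unfolding H0_def e_def
    using partial_compose[OF C2_differentiable[OF C2_nth] d1, of k k0 y] by (simp add: partial_nth)
  have eqH: "H y = H0 y" if "y \<in> ball 0 n" for y using that \<theta>1 by (simp add: H_def H0_def)
  have pH: "partial k H y = partial k H0 y" if "y \<in> ball 0 n" for k y
    by (rule partial_cong_open[OF open_ball that eqH])
  have pl: "partial l (\<lambda>y::real^'n. y $ k0) = (\<lambda>_. if l = k0 then 1 else 0)" for l
    by (rule ext) (simp add: partial_nth)
  have ppH: "partial k (partial l H) y = (if k = k0 then if l = k0 then - \<mu>\<^sup>2 * e y else 0 else 0)"
    if "y \<in> ball 0 n" for k l y
  proof -
    have "partial k (partial l H) y = partial k (partial l H0) y"
      by (rule partial_cong_open[OF open_ball that pH])
    also have "\<dots> = (if k = k0 then if l = k0 then - \<mu>\<^sup>2 * e y else 0 else 0)"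
      unfolding H0_def e_def
      by (subst partial2_compose[OF C2_nth d1 d2]) (auto intro!: continuous_intros simp: pl)
    finally show ?thesis .
  qed
  have gH: "grad H x \<bullet> z = - \<mu> * e x * z $ k0" if "x \<in> ball 0 n" for x z
    using that by (simp add: grad_inner_eq pH pH0 if_distrib cong: if_cong)

  \<comment> \<open>A lower bound for \<open>e\<close> on the ball of radius \<open>n\<close>, where
    the chosen coordinate is at least \<open>- n\<close>.\<close>
  define c where "c = exp (- \<mu> * (2 * n + 2))"
  have "generator b \<sigma> \<pi> Q (\<lambda>x i. H x) x i \<le> - c" if x: "norm x < n" for x i
  proof -
    have xb: "x \<in> ball 0 n" using x by simp
    have e0: "0 < e x" by (simp add: e_def)
    have diff: "(\<Sum>k\<in>UNIV. \<Sum>l\<in>UNIV. diffusion_matrix \<sigma> x i $ k $ l * partial k (partial l H) x)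
       = - (diffusion_matrix \<sigma> x i $ k0 $ k0 * (\<mu>\<^sup>2 * e x))"
    proof -
      have "diffusion_matrix \<sigma> x i $ k $ l * partial k (partial l H) x
        = (if l = k0 then if k = k0 then - (diffusion_matrix \<sigma> x i $ k0 $ k0 * (\<mu>\<^sup>2 * e x)) else 0 else 0)" for k l
        by (simp add: ppH[OF xb])
      then show ?thesis by simp
    qed
    have drift: "(\<Sum>k\<in>UNIV. b x i $ k * partial k H x) = - (b x i $ k0 * (\<mu> * e x))"
      by (simp add: pH[OF xb] pH0 if_distrib cong: if_cong)
    have switch: "(\<Sum>j\<in>UNIV. Q x $ i $ j * H x) = 0"
      using Q_row_sum[of x i] by (simp flip: sum_distrib_right)
    have jump: "(\<integral>z. jump_integrand H x z \<partial>\<pi> i x) \<le> e x * K"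
    proof -
      have Bs: "- ball 0 1 \<in> sets (\<pi> i x)" unfolding sets_jump_measure by auto
      have fin: "emeasure (\<pi> i x) (- ball 0 1) < \<infinity>" by (rule le_less_trans[OF K(2)]) simp
      \<comment> \<open>For small jumps the inequality \<open>1 + u \<le> exp u\<close> makes the
        compensated difference nonpositive; a big jump raises \<open>H\<close> from
        \<open>1 - e x\<close> to at most 1.\<close>
      have le: "jump_integrand H x z \<le> e x * indicator (- ball 0 1) z" for z
      proof (cases "norm z < 1")
        case True
        have "norm (x + z) \<le> n + 1" using norm_triangle_ineq[of x z] True x by linarith
        then have "H (x + z) = 1 - e (x + z)" by (simp add: H_def \<theta>1)
        also have "e (x + z) = e x * exp (\<mu> * z $ k0)" by (simp add: e_def algebra_simps flip: exp_add)
        finally have "H (x + z) = 1 - e x * exp (\<mu> * z $ k0)" .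
        moreover have "e x * (1 + \<mu> * z $ k0) \<le> e x * exp (\<mu> * z $ k0)"
          using exp_ge_add_one_self e0 by (intro mult_left_mono) auto
        ultimately show ?thesis
          using True eqH[OF xb] by (simp add: jump_integrand_def gH[OF xb] H0_def algebra_simps)
      next
        case False
        have "H (x + z) \<le> 1" by (rule H01)
        then show ?thesis using False eqH[OF xb] by (simp add: jump_integrand_def H0_def)
      qed
      have "(\<integral>z. jump_integrand H x z \<partial>\<pi> i x) \<le> (\<integral>z. e x * indicator (- ball 0 1) z \<partial>\<pi> i x)"
        using Bs fin
        by (intro integral_mono le C2b_integrable_jump_integrand C2_const_outside_C2b[OF C2H Hout]) auto
      also have "\<dots> = e x * measure (\<pi> i x) (- ball 0 1)"
        using Bs sets.sets_into_space[OF Bs] by (simp add: Int_absorb2 Int_absorb1)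
      also have "\<dots> \<le> e x * K"
        using K e0 by (intro mult_left_mono) (auto simp: measure_def intro!: enn2real_leI)
      finally show ?thesis .
    qed
    have "generator b \<sigma> \<pi> Q (\<lambda>x i. H x) x i
       \<le> (1/2) * - (diffusion_matrix \<sigma> x i $ k0 $ k0 * (\<mu>\<^sup>2 * e x)) - b x i $ k0 * (\<mu> * e x) + e x * K"
      unfolding generator_def diff drift switch using jump by simp
    also have "\<dots> \<le> (1/2) * - (\<kappa> * (\<mu>\<^sup>2 * e x)) + C * (\<mu> * e x) + e x * K"
    proof -
      have "\<kappa> * (\<mu>\<^sup>2 * e x) \<le> diffusion_matrix \<sigma> x i $ k0 $ k0 * (\<mu>\<^sup>2 * e x)"
        using a_ge[OF xb] e0 by (intro mult_right_mono) auto
      moreover have "- b x i $ k0 * (\<mu> * e x) \<le> C * (\<mu> * e x)"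
        using C[OF x, of i] e0 \<mu> by (intro mult_right_mono) auto
      ultimately show ?thesis by simp
    qed
    also have "\<dots> = - e x * ((1/2) * \<kappa> * \<mu>\<^sup>2 - C * \<mu> - K)" by (simp add: algebra_simps)
    also have "\<dots> \<le> - e x * 1" using \<mu>_large e0 by (intro mult_left_mono_neg) auto
    also have "\<dots> \<le> - c"
    proof -
      have "- n \<le> x $ k0" using component_le_norm_cart[of x k0] x by linarith
      then have "\<mu> * (- n - (n + 2)) \<le> \<mu> * (x $ k0 - (n + 2))" using \<mu> by (intro mult_left_mono) auto
      then show ?thesis by (simp add: c_def e_def algebra_simps)
    qed
    finally show ?thesis .
  qed
  moreover have "c > 0" by (simp add: c_def)
  ultimately show ?thesis using C2H H01 Hout by blast
qed

text \<open>Sets up \<open>W\<close> and \<open>\<rho>\<close> for fixed \<open>m\<close> and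
  \<open>\<delta>\<close> so that \<open>prob_avoid_le\<close> applies. The bound is
  \<open>W x i\<close>, with \<open>\<phi>\<close> estimated by its tangent at 0 and
  \<open>H\<close> by 1.\<close>

lemma prob_never_hits_le:
  fixes V :: "real^'n \<Rightarrow> 'm \<Rightarrow> real"
  assumes law: "solves_martingale_problem b \<sigma> \<pi> Q x i P"
    and D: "open D" "bounded D"
    and V_C2: "\<And>i. C2 (\<lambda>x. V x i)"
    and V_nonneg: "\<And>x i. 0 \<le> V x i"
    and GV_defined: "\<And>x i. x \<notin> D \<Longrightarrow> integrable (\<pi> i x) (jump_integrand (\<lambda>y. V y i) x)"
    and GV_nonpos: "\<And>x i. x \<notin> D \<Longrightarrow> generator b \<sigma> \<pi> Q V x i \<le> 0"
    and V_infinity: "filterlim (\<lambda>n::nat. INF (x, i)\<in>{x. real n \<le> norm x} \<times> UNIV. V x i) at_top sequentially"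
    and m: "0 < m" and \<delta>: "0 < \<delta>"
  shows "measure P {\<omega> \<in> space P. \<forall>t\<ge>0. fst (\<omega> t) \<notin> D} \<le> (2 / m) * (1 + V x i) + \<delta>"
proof -
  obtain r where r: "\<And>x. x \<in> D \<Longrightarrow> norm x \<le> r" using D(2) by (auto simp: bounded_iff)
  obtain n0 where n0: "\<And>n::nat. n0 \<le> n \<Longrightarrow> 3 * m \<le> (INF (x, i)\<in>{x. real n \<le> norm x} \<times> UNIV. V x i)"
    using V_infinity by (auto simp: filterlim_at_top eventually_sequentially)
  \<comment> \<open>The ball of this radius contains \<open>D\<close>, and \<open>V\<close> is at
    least \<open>3 * m\<close> outside it.\<close>
  define n where "n = max (max n0 1) (nat \<lceil>r\<rceil> + 1)"
  have n: "n0 \<le> n" "0 < real n" "r < real n" unfolding n_def by (simp, simp, linarith)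
  have V_large: "3 * m \<le> V y j" if "real n \<le> norm y" for y j
  proof -
    \<comment> \<open>A real-valued \<open>INF\<close> is a lower bound for a family bounded below;
      nonnegativity of \<open>V\<close> provides this.\<close>
    have "(INF (x, i)\<in>{x. real n \<le> norm x} \<times> UNIV. V x i) \<le> V y j"
      using that V_nonneg by (intro cINF_lower2[of _ _ "(y, j)"] bdd_belowI2[where m = 0]) auto
    then show ?thesis using n0[OF n(1)] by linarith
  qed
  have D_sub: "norm y < real n" if "y \<in> D" for y using r[OF that] n by linarith

  \<comment> \<open>The scale \<open>3 * m\<close> gives value 1 and slope 1 at 0, hence
    \<open>\<phi> v \<le> 1 + v\<close> by concavity. From \<open>3 * m\<close> on the value is
    \<open>1 + m\<close>, and \<open>2 / m\<close> times this exceeds 2.\<close>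
  define \<phi> where "\<phi> v = 1 + m - m * max 0 (1 - v / (3 * m)) ^ 3" for v
  define \<phi>1 where "\<phi>1 v = (max 0 (1 - v / (3 * m)))\<^sup>2" for v
  define \<phi>2 where "\<phi>2 v = - (2 / (3 * m)) * max 0 (1 - v / (3 * m))" for v
  have lin: "((\<lambda>v. 1 - v / (3 * m)) has_real_derivative - 1 / (3 * m)) (at v)" for v
    using m by (auto intro!: derivative_eq_intros)
  have d1: "(\<phi> has_real_derivative \<phi>1 v) (at v)" for v
    using DERIV_diff[OF DERIV_const DERIV_cmult[OF DERIV_chain2[OF DERIV_pos_part_power[of 1] lin[of v]], of m], of "1 + m"] m
    by (simp add: \<phi>_def[abs_def] \<phi>1_def numeral_3_eq_3 numeral_2_eq_2 field_simps)
  have d2: "(\<phi>1 has_real_derivative \<phi>2 v) (at v)" for v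
    using DERIV_chain2[OF DERIV_pos_part_power[of 0] lin[of v]] m
    by (simp add: \<phi>1_def[abs_def] \<phi>2_def numeral_2_eq_2 field_simps)
  have c2: "continuous_on UNIV \<phi>2" unfolding \<phi>2_def[abs_def] using m by (intro continuous_intros) auto
  have nonpos: "\<phi>2 v \<le> 0" for v using m by (simp add: \<phi>2_def)
  have tangent: "\<phi> t \<le> \<phi> s + \<phi>1 s * (t - s)" for s t
  proof -
    define u v where "u = 1 - s / (3 * m)" and "v = 1 - t / (3 * m)"
    have ts: "t - s = 3 * m * (u - v)" using m by (simp add: u_def v_def field_simps)
    show ?thesis
      using mult_left_mono[OF pos_part_cube_tangent[of u v], of m] m
      unfolding \<phi>_def \<phi>1_def ts u_def[symmetric] v_def[symmetric] by (simp add: algebra_simps)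
  qed
  have \<phi>_ge: "1 \<le> \<phi> v" "\<phi> v \<le> 1 + m" if "0 \<le> v" for v
  proof -
    have "max 0 (1 - v / (3 * m)) ^ 3 \<le> 1" using that m by (intro power_le_one) auto
    then show "1 \<le> \<phi> v" using m by (simp add: \<phi>_def)
    show "\<phi> v \<le> 1 + m" using m by (simp add: \<phi>_def)
  qed
  have \<phi>_le: "\<phi> v \<le> 1 + v" for v using tangent[of v 0] by (simp add: \<phi>_def \<phi>1_def)
  have \<phi>_large: "\<phi> v = 1 + m" if "3 * m \<le> v" for v
    using that m by (simp add: \<phi>_def max_def field_simps)

  obtain H c R where H: "C2 H" "\<forall>x. 0 \<le> H x \<and> H x \<le> 1" "\<forall>x. R \<le> norm x \<longrightarrow> H x = 1" "0 < c"
    "\<forall>x i. norm x < real n \<longrightarrow> generator b \<sigma> \<pi> Q (\<lambda>x i. H x) x i \<le> - c"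
    using local_strict_supersolution[OF n(2)] by blast
  have H01: "0 \<le> H y" "H y \<le> 1" for y using H(2) by auto
  have H_out: "H y = 1" if "R \<le> norm y" for y using H(3) that by blast
  define F where "F y j = \<phi> (V y j)" for y j
  define W where "W y j = (2 / m) * F y j + \<delta> * H y" for y j
  have C2F: "C2 (\<lambda>y. F y j)" for j unfolding F_def by (rule C2_compose[OF V_C2 d1 d2 c2])
  have F_out: "F y j = 1 + m" if "real n \<le> norm y" for y j
    using V_large[OF that] by (simp add: F_def \<phi>_large)
  have C2bF: "C2b (\<lambda>y. F y j)" for j by (rule C2_const_outside_C2b[OF C2F F_out])
  have C2bH: "C2b H" by (rule C2_const_outside_C2b[OF H(1) H_out])
  have C2W: "C2 (\<lambda>y. W y j)" for j unfolding W_def by (rule C2_linear_combination[OF C2F H(1)])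
  have W_out: "W y j = (2 / m) * (1 + m) + \<delta>" if "max (real n) R \<le> norm y" for y j
    using that by (simp add: W_def F_out H_out)
  have C2bW: "C2b (\<lambda>y. W y j)" for j by (rule C2_const_outside_C2b[OF C2W W_out])
  have "\<exists>C\<ge>0. \<forall>x i. \<bar>generator b \<sigma> \<pi> Q W x i\<bar> \<le> C"
    by (rule generator_bounded[OF C2W W_out])
  then obtain C where C: "0 \<le> C" "\<forall>x i. \<bar>generator b \<sigma> \<pi> Q W x i\<bar> \<le> C"
    by blast

  define \<eta> where "\<eta> = \<delta> * c"
  \<comment> \<open>The summand \<open>C * m / 2\<close> outweighs the generator on
    \<open>D\<close>, where \<open>W\<close> is at least \<open>2 / m\<close>; \<open>C\<close> does
    so outside the ball, where \<open>W\<close> is at least 2; the last summand gives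
    \<open>\<eta> \<le> \<Lambda>\<close>.\<close>
  define \<Lambda> where "\<Lambda> = C + C * m / 2 + \<eta>"
  define \<rho> where "\<rho> y = (if y \<in> D \<or> real n \<le> norm y then \<Lambda> else \<eta>)" for y :: "real^'n"
  have \<eta>: "0 < \<eta>" using \<delta> H(4) by (simp add: \<eta>_def)
  have \<eta>\<Lambda>: "\<eta> \<le> \<Lambda>" using C(1) m by (simp add: \<Lambda>_def)
  have W_ge: "2 / m \<le> W y j" for y j
  proof -
    have "(2 / m) * 1 \<le> (2 / m) * F y j"
      using \<phi>_ge(1)[OF V_nonneg] m unfolding F_def by (intro mult_left_mono) auto
    moreover have "0 \<le> \<delta> * H y" using \<delta> H01(1) by simp
    ultimately show ?thesis by (simp add: W_def)
  qed
  have W_nonneg: "0 \<le> W y j" for y j by (rule order_trans[OF _ W_ge]) (use m in simp)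
  have W_le: "W y j \<le> (2 / m) * (1 + m) + \<delta>" for y j
  proof -
    have "(2 / m) * F y j \<le> (2 / m) * (1 + m)"
      using \<phi>_ge(2)[OF V_nonneg] m unfolding F_def by (intro mult_left_mono) auto
    moreover have "\<delta> * H y \<le> \<delta> * 1" using \<delta> H01(2) by (intro mult_left_mono) auto
    ultimately show ?thesis by (simp add: W_def)
  qed
  have super: "generator b \<sigma> \<pi> Q W y j - \<rho> y * W y j \<le> - (\<rho> y * indicator (- D) y)" for y j
  proof -
    have GC: "generator b \<sigma> \<pi> Q W y j \<le> C" using C(2)[rule_format, of y j] by linarith
    consider "y \<in> D" | "y \<notin> D" "real n \<le> norm y" | "y \<notin> D" "norm y < real n" by linarith
    then show ?thesis
    proof cases
      case 1
      have "C \<le> \<Lambda> * (2 / m)" using C(1) \<eta> m by (simp add: \<Lambda>_def field_simps)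
      also have "\<dots> \<le> \<Lambda> * W y j" using \<eta> \<eta>\<Lambda> W_ge by (intro mult_left_mono) auto
      finally show ?thesis using 1 GC by (simp add: \<rho>_def)
    next
      case 2
      have "2 \<le> (2 / m) * F y j" using m by (simp add: F_out[OF 2(2)] field_simps)
      moreover have "0 \<le> \<delta> * H y" using \<delta> H01(1) by simp
      ultimately have "2 \<le> W y j" by (simp add: W_def)
      then have "\<Lambda> * 2 \<le> \<Lambda> * W y j" using \<eta> \<eta>\<Lambda> by (intro mult_left_mono) auto
      moreover have "C \<le> \<Lambda>" using C(1) \<eta> m by (simp add: \<Lambda>_def)
      ultimately show ?thesis using 2 GC by (simp add: \<rho>_def)
    next
      \<comment> \<open>Here the part built from \<open>V\<close> has nonpositive generator, and the
        strict decrease by \<open>\<eta>\<close> comes from \<open>\<delta> * H y\<close>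
        alone.\<close>
      case 3
      have "generator b \<sigma> \<pi> Q F y j \<le> \<phi>1 (V y j) * generator b \<sigma> \<pi> Q V y j"
        unfolding F_def
        by (rule generator_concave_compose_le[OF V_C2 d1 d2 c2 nonpos tangent GV_defined[OF 3(1)]
              C2b_integrable_jump_integrand[OF C2bF[unfolded F_def]]])
      also have "\<dots> \<le> 0" using GV_nonpos[OF 3(1)] by (intro mult_nonneg_nonpos) (auto simp: \<phi>1_def)
      finally have F0: "generator b \<sigma> \<pi> Q F y j \<le> 0" .
      have "generator b \<sigma> \<pi> Q W y j = (2 / m) * generator b \<sigma> \<pi> Q F y j + \<delta> * generator b \<sigma> \<pi> Q (\<lambda>y j. H y) y j"
        unfolding W_def
        by (rule generator_linear_combination[OF C2F H(1) C2b_integrable_jump_integrand[OF C2bF] C2b_integrable_jump_integrand[OF C2bH]])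
      moreover have "(2 / m) * generator b \<sigma> \<pi> Q F y j \<le> 0" using F0 m by (intro mult_nonneg_nonpos) auto
      moreover have "\<delta> * generator b \<sigma> \<pi> Q (\<lambda>y j. H y) y j \<le> \<delta> * - c"
        using H(5)[rule_format, OF 3(2)] \<delta> by (intro mult_left_mono) auto
      ultimately have "generator b \<sigma> \<pi> Q W y j \<le> - \<eta>" by (simp add: \<eta>_def)
      moreover have "0 \<le> \<eta> * W y j" using \<eta> W_nonneg by simp
      ultimately show ?thesis using 3 by (simp add: \<rho>_def)
    qed
  qed
  have \<rho>_meas: "\<rho> \<in> borel_measurable borel"
  proof -
    have [measurable]: "D \<in> sets borel" using D(1) by simp
    show ?thesis unfolding \<rho>_def[abs_def] by measurable
  qed
  have mp: "prob_space P" "sets P = sets skorohod_space"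
    "AE \<omega> in P. \<forall>t\<ge>0. set_integrable lborel {0..t} (\<lambda>s. generator b \<sigma> \<pi> Q W (fst (\<omega> s)) (snd (\<omega> s)))"
    "is_martingale P path_filtration
       (\<lambda>t \<omega>. W (fst (\<omega> t)) (snd (\<omega> t)) - W (fst (\<omega> 0)) (snd (\<omega> 0))
          - (LINT s:{0..t}|lborel. generator b \<sigma> \<pi> Q W (fst (\<omega> s)) (snd (\<omega> s))))"
    using law C2bW unfolding solves_martingale_problem_def Let_def by auto
  interpret P: prob_space P by (rule mp)
  interpret killed_supersolution P W "generator b \<sigma> \<pi> Q W" \<rho> D "(2 / m) * (1 + m) + \<delta>" C \<Lambda>
    using mp C W_nonneg W_le \<rho>_meas super D \<eta> \<eta>\<Lambda> C2W
    by unfold_locales (auto simp: \<rho>_def intro: C2_continuous)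
  have "P.prob avoid \<le> W x i"
    by (rule prob_avoid_le[OF solves_martingale_problem_initial[OF law] \<eta>]) (simp add: \<rho>_def \<eta>\<Lambda>)
  also have "W x i \<le> (2 / m) * (1 + V x i) + \<delta> * 1"
    unfolding W_def F_def using m \<delta> \<phi>_le H01(2) by (intro add_mono mult_left_mono) auto
  finally show ?thesis by (simp add: avoid_def)
qed

end

text \<open>Since \<open>V\<close> may be unbounded, its jump integral could diverge and the Bochner
  integral would then be 0 by convention; \<open>GV_defined\<close> ensures that the sign condition
  concerns a convergent integral.\<close>

theorem theorem3p5:
  fixes b :: "real^'n::finite \<Rightarrow> 'm::finite \<Rightarrow> real^'n"
    and \<sigma> :: "real^'n \<Rightarrow> 'm \<Rightarrow> real^'n^'n"
    and \<pi> :: "'m \<Rightarrow> real^'n \<Rightarrow> (real^'n) measure"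
    and Q :: "real^'n \<Rightarrow> real^'m^'m"
    and P :: "real^'n \<Rightarrow> 'm \<Rightarrow> (real \<Rightarrow> (real^'n) \<times> 'm) measure"
    and D :: "(real^'n) set"
    and V :: "real^'n \<Rightarrow> 'm \<Rightarrow> real"
  assumes standing: "regime_switching_jump_diffusion b \<sigma> \<pi> Q"
    and law: "\<And>x i. solves_martingale_problem b \<sigma> \<pi> Q x i (P x i)"
    and D: "is_domain D" "bounded D"
    and V_C2: "\<And>i. C2 (\<lambda>x. V x i)"
    and V_nonneg: "\<And>x i. 0 \<le> V x i"
    and GV_defined:
      "\<And>x i. x \<notin> D \<Longrightarrow> integrable (\<pi> i x) (jump_integrand (\<lambda>y. V y i) x)"
    and GV_nonpos: "\<And>x i. x \<notin> D \<Longrightarrow> generator b \<sigma> \<pi> Q V x i \<le> 0"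
    and V_infinity:
      "filterlim (\<lambda>n::nat. INF (x, i)\<in>{x. real n \<le> norm x} \<times> UNIV. V x i) at_top sequentially"
  shows "recurrent P (D \<times> UNIV)"
  unfolding recurrent_def
proof (intro allI impI)
  fix x :: "real^'n" and i :: 'm
  interpret regime_switching_jump_diffusion b \<sigma> \<pi> Q by (rule standing)
  interpret P: prob_space "P x i" using law[of x i] by (simp add: solves_martingale_problem_def)
  have sets: "sets (P x i) = sets skorohod_space" using law[of x i] by (simp add: solves_martingale_problem_def)
  have op: "open D" using D(1) by (simp add: is_domain_def)
  let ?N = "{\<omega> \<in> space (P x i). \<forall>t\<ge>0. fst (\<omega> t) \<notin> D}"
  have "P.prob ?N \<le> 0 + \<epsilon>" if \<epsilon>: "0 < \<epsilon>" for \<epsilon>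
  proof -
    \<comment> \<open>This choice turns the first term of the bound into
      \<open>\<epsilon> / 2\<close>, the same as the value taken for
      \<open>\<delta>\<close>.\<close>
    let ?m = "4 * (1 + V x i) / \<epsilon>"
    have pos: "0 < 1 + V x i" using V_nonneg[of x i] by linarith
    have "P.prob ?N \<le> (2 / ?m) * (1 + V x i) + \<epsilon> / 2"
      using pos \<epsilon> by (intro prob_never_hits_le[OF law op D(2) V_C2 V_nonneg GV_defined GV_nonpos V_infinity]) auto
    also have "\<dots> = \<epsilon>" using pos \<epsilon> by (simp add: field_simps)
    finally show ?thesis by simp
  qed
  then have "P.prob ?N \<le> 0" by (rule field_le_epsilon)
  then have "P.prob ?N = 0" by (simp add: measure_le_0_iff)
  moreover have "{\<omega> \<in> space (P x i). hitting_time (D \<times> UNIV) \<omega> < \<infinity>} = space (P x i) - ?N"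
  proof -
    \<comment> \<open>In \<open>ereal\<close> the infimum of the empty set is infinite, so
      finiteness says exactly that some hit occurs; the infimum need not be attained.\<close>
    have "hitting_time (D \<times> UNIV) \<omega> < \<infinity> \<longleftrightarrow> (\<exists>t\<ge>0. fst (\<omega> t) \<in> D)" for \<omega> :: "real \<Rightarrow> (real^'n) \<times> 'm"
      unfolding hitting_time_def Inf_less_iff by (auto simp: mem_Times_iff)
    then show ?thesis by auto
  qed
  ultimately show "P.prob {\<omega> \<in> space (P x i). hitting_time (D \<times> UNIV) \<omega> < \<infinity>} = 1"
    using P.prob_compl[OF sets_never_hits[OF op sets]] by simp
qed

end
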